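(* Let $V$, $f$, $u_0$, $u_1$ satisfy the assumptions (A0)–(A3) listed in the context, and let $u$ be a $C^1$-solution on $[0,\infty)\times[0,\infty)$ of $$\begin{cases} V(x)u_{tt}(x,t)-u_{xx}(x,t)=0, & x\in[0,\infty),\ t\in[0,\infty),\\ u_x(0,t)=(f(u_t(0,t)))_t, & t\in[0,\infty),\\ u(x,0)=u_0(x),\quad u_t(x,0)=u_1(x), & x\in[0,\infty),\end{cases}$$ with $u_0'(x),u_1(x)\to0$ as $x\to\infty$. Then the momentum $$M(u,t)=\int_0^\infty V(x)u_t(x,t)\,\mathrm{d}x+f(u_t(0,t))$$ and the energy $$E(u,t)=\tfrac12\int_0^\infty\left(V(x)u_t(x,t)^2+u_x(x,t)^2\right)\mathrm{d}x+F(u_t(0,t)),\qquad F(s)=sf(s)-\int_0^sf(\sigma)\,\mathrm{d}\sigma,$$ are time-invariant.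
   Context: All functions are real-valued. For a closed interval $I\subseteq\mathbb{R}$, a function $\phi:I\to\mathbb{R}$ is piecewise $C^k$, written $\phi\in PC^k(I)$, if there is a discrete set $D\subseteq I$ with $\phi\in C^k(I\setminus D)$ such that the one-sided limits $\phi^{(j)}(x-)$, $\phi^{(j)}(x+)$ exist for all $x\in D$, $0\le j\le k$ (they need not coincide); if $I$ is bounded from below (above), also $\phi^{(j)}(\min I+)$ (resp. $\phi^{(j)}(\max I-)$) is required to exist for $0\le j\le k$. $D(\phi)$ denotes the set of discontinuities of $\phi$. Assumptions: (A0) $u_0\in C^1([0,\infty))$, $u_1\in C([0,\infty))$. (A1) $V\in PC^1([0,\infty))$, $V,V'\in L^\infty$, $\inf V>0$. (A2) $\inf\{|d_1-d_2| : d_1,d_2\in D(V)\cup\{0\},\ d_1\neq d_2\}>0$. (A3) $f:\mathbb{R}\to\mathbb{R}$ is an increasing homeomorphism. Put $c(x)=1/\sqrt{V(x)}$. A $C^1$-solution on $[0,\infty)^2$ with initial data $(u_0,u_1)$ is a function $u\in C^1([0,\infty)\times[0,\infty))$ such that: (i) for all $(x,t)\in[0,\infty)^2$ with $x\notin D(c)\cup D(c')$, $(\partial_t-c(x)\partial_x)(u_t+c(x)u_x)(x,t)=-c(x)c'(x)u_x(x,t)$, where the outer operator is understood as a directional derivative; (ii) $(f(u_t(0,t)))_t=u_x(0,t)$ for all $t\ge0$; (iii) $u(x,0)=u_0(x)$ and $u_t(x,0)=u_1(x)$ for all $x\ge0$. *)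

theory Defs
  imports "HOL-Analysis.Analysis"
begin

text \<open>Derivative of a function on the half-line; at \<open>0\<close> it is the right-sided derivative.\<close>

definition hderiv :: "(real \<Rightarrow> real) \<Rightarrow> real \<Rightarrow> real" where
  "hderiv \<phi> x = vector_derivative \<phi> (at x within {0..})"

definition C1_on :: "'a::real_normed_vector set \<Rightarrow> ('a \<Rightarrow> 'b::real_normed_vector) \<Rightarrow> bool" where
  "C1_on S \<phi> \<longleftrightarrow> (\<exists>D :: 'a \<Rightarrow> 'a \<Rightarrow>\<^sub>L 'b.
     (\<forall>p\<in>S. (\<phi> has_derivative blinfun_apply (D p)) (at p within S)) \<and> continuous_on S D)"

text \<open>
  The class \<open>PC\<^sup>k(I)\<close> for a closed interval \<open>I\<close>. The exceptional set \<open>D\<close> has no accumulation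
  point in \<open>I\<close>, so that \<open>I - D\<close> is relatively open in \<open>I\<close>. The function \<open>d j\<close> is the
  \<open>j\<close>-th derivative; its values on \<open>D\<close> are irrelevant for \<open>j > 0\<close>. At an end point of \<open>I\<close>
  one of the two filters is trivial, so only the limit from inside \<open>I\<close> is required.
\<close>

definition piecewise_C :: "nat \<Rightarrow> real set \<Rightarrow> (real \<Rightarrow> real) \<Rightarrow> bool" where
  "piecewise_C k I \<phi> \<longleftrightarrow> (\<exists>D d. D \<subseteq> I \<and> (\<forall>x\<in>I. \<not> x islimpt D) \<and> d 0 = \<phi> \<and>
     (\<forall>j<k. \<forall>x\<in>I - D. (d j has_real_derivative d (Suc j) x) (at x within I)) \<and>
     (\<forall>j\<le>k. continuous_on (I - D) (d j)) \<and>
     (\<forall>j\<le>k. \<forall>x\<in>D \<union> frontier I.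
        (\<exists>l. (d j \<longlongrightarrow> l) (at x within I \<inter> {..<x})) \<and>
        (\<exists>l. (d j \<longlongrightarrow> l) (at x within I \<inter> {x<..}))))"

definition discont :: "(real \<Rightarrow> real) \<Rightarrow> real set" where
  "discont \<phi> = {x \<in> {0..}. \<not> continuous (at x within {0..}) \<phi>}"

text \<open>Points at which the derivative is undefined count as discontinuities of the derivative.\<close>

definition discont_deriv :: "(real \<Rightarrow> real) \<Rightarrow> real set" where
  "discont_deriv \<phi> = {x \<in> {0..}. \<not> \<phi> differentiable (at x within {0..})} \<union> discont (hderiv \<phi>)"

text \<open>Membership in \<open>L\<^sup>\<infinity>\<close> of the half-line, for functions whose measurability is clear.\<close>

definition ess_bounded :: "(real \<Rightarrow> real) \<Rightarrow> bool" where
  "ess_bounded \<phi> \<longleftrightarrow> (\<exists>C. AE x in lborel. 0 \<le> x \<longrightarrow> \<bar>\<phi> x\<bar> \<le> C)"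

definition increasing_homeomorphism :: "(real \<Rightarrow> real) \<Rightarrow> bool" where
  "increasing_homeomorphism f \<longleftrightarrow> strict_mono f \<and> (\<exists>g. homeomorphism UNIV UNIV f g)"

definition partial_x :: "(real \<Rightarrow> real \<Rightarrow> real) \<Rightarrow> real \<Rightarrow> real \<Rightarrow> real" where
  "partial_x u x t = hderiv (\<lambda>y. u y t) x"

definition partial_t :: "(real \<Rightarrow> real \<Rightarrow> real) \<Rightarrow> real \<Rightarrow> real \<Rightarrow> real" where
  "partial_t u x t = hderiv (\<lambda>s. u x s) t"

definition speed :: "(real \<Rightarrow> real) \<Rightarrow> real \<Rightarrow> real" where
  "speed V x = 1 / sqrt (V x)"

text \<open>
  The operator \<open>\<partial>\<^sub>t - c(x) \<partial>\<^sub>x\<close> applied to \<open>w\<close> at \<open>(x, t)\<close> is the directional derivative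
  of \<open>w\<close> in the direction \<open>(- c(x), 1)\<close>; \<open>w\<close> itself need not have partial derivatives.
  Only increments staying in the closed quadrant are admitted: on its boundary the derivative
  is one-sided, and at the corner \<open>(0, 0)\<close>, which the line meets in no other point of the
  quadrant, the condition is void.
\<close>

definition has_transport_derivative ::
    "(real \<Rightarrow> real) \<Rightarrow> (real \<Rightarrow> real \<Rightarrow> real) \<Rightarrow> real \<Rightarrow> real \<Rightarrow> real \<Rightarrow> bool" where
  "has_transport_derivative c w x t d \<longleftrightarrow>
     ((\<lambda>h. w (x - c x * h) (t + h)) has_real_derivative d)
       (at 0 within {h. 0 \<le> x - c x * h \<and> 0 \<le> t + h})"

definition C1_solution :: "(real \<Rightarrow> real) \<Rightarrow> (real \<Rightarrow> real) \<Rightarrow> (real \<Rightarrow> real) \<Rightarrow> (real \<Rightarrow> real) \<Rightarrow>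
    (real \<Rightarrow> real \<Rightarrow> real) \<Rightarrow> bool" where
  "C1_solution V f u0 u1 u \<longleftrightarrow>
     C1_on ({0..} \<times> {0..}) (\<lambda>(x, t). u x t) \<and>
     (\<forall>x\<ge>0. \<forall>t\<ge>0. x \<notin> discont (speed V) \<union> discont_deriv (speed V) \<longrightarrow>
        has_transport_derivative (speed V)
          (\<lambda>y s. partial_t u y s + speed V y * partial_x u y s) x t
          (- speed V x * hderiv (speed V) x * partial_x u x t)) \<and>
     (\<forall>t\<ge>0. ((\<lambda>s. f (partial_t u 0 s)) has_real_derivative partial_x u 0 t) (at t within {0..})) \<and>
     (\<forall>x\<ge>0. u x 0 = u0 x \<and> partial_t u x 0 = u1 x)"

text \<open>
  Decay of the data does not make \<open>V u\<^sub>t\<close> absolutely integrable, so the integral in the momentum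
  is an improper one: \<open>has_momentum V f u t m\<close> states that \<open>M(u, t)\<close> exists, possibly as an
  infinite value, and equals \<open>m\<close>.
\<close>

definition has_momentum :: "(real \<Rightarrow> real) \<Rightarrow> (real \<Rightarrow> real) \<Rightarrow> (real \<Rightarrow> real \<Rightarrow> real) \<Rightarrow> real \<Rightarrow>
    ereal \<Rightarrow> bool" where
  "has_momentum V f u t m \<longleftrightarrow>
     ((\<lambda>R. ereal ((LBINT x:{0..R}. V x * partial_t u x t) + f (partial_t u 0 t))) \<longlongrightarrow> m) at_top"

definition boundary_energy :: "(real \<Rightarrow> real) \<Rightarrow> real \<Rightarrow> real" where
  "boundary_energy f s = s * f s - (LBINT \<sigma>=0..ereal s. f \<sigma>)"

text \<open>The integrand is nonnegative; the energy is \<open>\<infinity>\<close> when it is not integrable.\<close>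

definition energy :: "(real \<Rightarrow> real) \<Rightarrow> (real \<Rightarrow> real) \<Rightarrow> (real \<Rightarrow> real \<Rightarrow> real) \<Rightarrow> real \<Rightarrow> ereal" where
  "energy V f u t =
     ereal (1 / 2) * enn2ereal (\<integral>\<^sup>+x\<in>{0..}.
       ennreal (V x * (partial_t u x t)\<^sup>2 + (partial_x u x t)\<^sup>2) \<partial>lborel) +
     ereal (boundary_energy f (partial_t u 0 t))"

end

theory Submission
  imports Defs
begin

text \<open>
  Put \<open>c = 1 / sqrt V\<close> and \<open>w = u\<^sub>t + c u\<^sub>x\<close>. The solution is only \<open>C\<^sup>1\<close>, so the wave equation has to be
  recovered from the transport equation for \<open>w\<close>, and that equation is weak in a particular way: between
  the jumps of \<open>V\<close>, \<open>w\<close> is merely continuous, and at every point it has a derivative along the straight line tangent to the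
  characteristic \<open>dx/dt = - c\<close>, not along the characteristic itself. But the tangent leaves the
  characteristic only by \<open>o(h)\<close>. Following tangents for many short steps gives a polygon close to the
  characteristic, along which the increment of \<open>w\<close> is under control, and continuity of \<open>w\<close> transfers
  the result to the curve (\<open>characteristic_integral_of_drifting_steps\<close>, \<open>riemann_invariant_deriv\<close>).

  For fixed times \<open>s \<le> t\<close>, the integrals \<open>\<integral> w(x, r) dr\<close> over \<open>[s, t]\<close> at different \<open>x\<close> can be compared along
  characteristics, since these are translates of each other in time. Hence they can be
  differentiated in \<open>x\<close>, and as \<open>\<integral> u\<^sub>t dr\<close> telescopes one obtains the wave equation integrated in time,
  \<open>d/dx \<integral> u\<^sub>x(x, r) dr = V(x) (u\<^sub>t(x, t) - u\<^sub>t(x, s))\<close>,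
  wherever \<open>V\<close> is \<open>C\<^sup>1\<close> (\<open>time_integrated_flux_deriv\<close>). The differentiated function is continuous across the
  jumps of \<open>V\<close>, which are finitely many in every bounded interval, so that integration in \<open>x\<close> needs no
  separate treatment of the jumps.

  Energy. The forward means \<open>p\<close> and \<open>q\<close> of \<open>u\<^sub>t\<close> and \<open>u\<^sub>x\<close> over time intervals of length \<open>h\<close> satisfy
  \<open>p\<^sub>x = q\<^sub>t\<close> and \<open>q\<^sub>x = V p\<^sub>t\<close> classically. Multiplying by a weight \<open>\<omega>\<close> with
  \<open>\<bar>\<omega>\<^sub>x\<bar> / sqrt m \<le> - \<omega>\<^sub>t\<close>, where \<open>m \<le> V\<close>, and letting \<open>h \<rightarrow> 0\<close> gives an energy inequality in which no second
  derivative of \<open>u\<close> occurs (\<open>weighted_energy_inequality\<close>). The inequality is linear in \<open>\<omega>\<close>, so \<open>\<omega>\<close> may be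
  negative: a weight supported in a backward cone bounds later energies by earlier ones, and the
  negative of a weight supported in a forward cone bounds earlier energies by later ones. Letting the
  cones exhaust the quadrant yields \<open>E(t) \<le> E(s)\<close> for all \<open>s\<close> and \<open>t\<close> in either order
  (\<open>total_energy_mono\<close>), with both sides possibly infinite. The term at \<open>x = 0\<close> is
  \<open>\<integral> u\<^sub>t u\<^sub>x dt = \<integral> u\<^sub>t d(f(u\<^sub>t))\<close>, the increment of the boundary energy, since \<open>dF(y) = y d(f(y))\<close> holds for
  monotone \<open>f\<close> even if \<open>y\<close> is not differentiable (\<open>boundary_energy_deriv\<close>).

  Momentum. Truncated at \<open>R\<close>, it changes between \<open>s\<close> and \<open>t\<close> by exactly \<open>\<integral> u\<^sub>x(R, r) dr\<close> over \<open>[s, t]\<close>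
  (\<open>truncated_momentum_increment\<close>). Energy travels at speed at most \<open>1 / sqrt m\<close> and the data decay, so the
  energy in \<open>[R, R + 1]\<close> tends to \<open>0\<close> uniformly on bounded time intervals (\<open>local_energy_decay\<close>). This
  controls the mean of the flux over \<open>[R, R + 1]\<close> as well as its oscillation there, hence the flux at \<open>R\<close>.
\<close>

section \<open>Functions controlled along drifting steps\<close>

lemma continuous_on_uncurried:
  assumes "continuous_on S (\<lambda>(x, y). F x y)" "continuous_on A g" "continuous_on A h"
    and "\<And>v. v \<in> A \<Longrightarrow> (g v, h v) \<in> S"
  shows "continuous_on A (\<lambda>v. F (g v) (h v))"
proof -
  have "continuous_on A (\<lambda>v. case (g v, h v) of (x, y) \<Rightarrow> F x y)"
    using assms(4) by (intro continuous_on_compose2[OF assms(1)] continuous_on_Pair assms(2,3)) auto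
  then show ?thesis by simp
qed

lemma has_real_derivative_bound:
  fixes f :: "real \<Rightarrow> real"
  assumes "(f has_real_derivative f') (at x within S)" "e > 0"
  shows "\<exists>r>0. \<forall>y\<in>S. \<bar>y - x\<bar> < r \<longrightarrow> \<bar>f y - f x - f' * (y - x)\<bar> \<le> e * \<bar>y - x\<bar>"
  using assms unfolding has_field_derivative_def has_derivative_within_alt real_norm_def by blast

text \<open>
  The first coordinate \<open>x\<close> is a position on a characteristic and \<open>z\<close> labels the characteristics. From every
  point there is an arbitrarily short step forward in \<open>x\<close> that nearly stays on its characteristic and
  along which \<open>W\<close> grows nearly at the rate \<open>k\<close>. Chaining such steps, the total drift in \<open>z\<close> is bounded by
  \<open>e (b - a)\<close> for any prescribed \<open>e\<close>. A supremum argument shows that the chain can be continued up to \<open>b\<close>,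
  and as \<open>e \<rightarrow> 0\<close> the continuity of \<open>W\<close> removes the drift.
\<close>
lemma characteristic_integral_of_drifting_steps:
  fixes W k :: "real \<Rightarrow> real \<Rightarrow> real"
  assumes ab: "a < b" and z: "p < z" "z < q"
    and contW: "continuous_on ({a..b} \<times> {p..q}) (\<lambda>(x, z). W x z)"
    and contk: "continuous_on ({a..b} \<times> {p..q}) (\<lambda>(x, z). k x z)"
    and step: "\<And>x z e. a \<le> x \<Longrightarrow> x < b \<Longrightarrow> p < z \<Longrightarrow> z < q \<Longrightarrow> e > 0 \<Longrightarrow>
      \<exists>x' z'. x < x' \<and> x' \<le> b \<and> x' - x < e \<and> \<bar>z' - z\<bar> \<le> e * (x' - x) \<and>
        \<bar>W x' z' - W x z - (x' - x) * k x z\<bar> \<le> e * (x' - x)"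
  shows "W b z - W a z = integral {a..b} (\<lambda>x. k x z)"
proof -
  define K where "K x = integral {a..x} (\<lambda>r. k r z)" for x
  have contkz: "continuous_on {a..b} (\<lambda>x. k x z)"
    by (rule continuous_on_uncurried[OF contk]) (use z in \<open>auto intro!: continuous_intros\<close>)
  have K_deriv: "(K has_real_derivative k x z) (at x within {a..b})" if "x \<in> {a..b}" for x
    unfolding K_def using integral_has_real_derivative[OF contkz that] .
  have K_cont: "continuous_on {a..b} K"
    by (rule DERIV_continuous_on[OF K_deriv])
  have compact_rect: "compact ({a..b} \<times> {p..q})"
    by (intro compact_Times) auto
  have bound: "\<bar>W b z - W a z - K b\<bar> \<le> \<eta> * (1 + 3 * (b - a))" if \<eta>: "\<eta> > 0" for \<eta>
  proof -
    obtain d1 where d1: "d1 > 0" and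
      W_uc: "\<And>v v'. v \<in> {a..b} \<times> {p..q} \<Longrightarrow> v' \<in> {a..b} \<times> {p..q} \<Longrightarrow> dist v' v < d1
        \<Longrightarrow> dist (case v' of (x, z) \<Rightarrow> W x z) (case v of (x, z) \<Rightarrow> W x z) < \<eta>"
      using compact_uniformly_continuous[OF contW compact_rect] \<eta>
      unfolding uniformly_continuous_on_def by metis
    obtain d2 where d2: "d2 > 0" and
      k_uc: "\<And>v v'. v \<in> {a..b} \<times> {p..q} \<Longrightarrow> v' \<in> {a..b} \<times> {p..q} \<Longrightarrow> dist v' v < d2
        \<Longrightarrow> dist (case v' of (x, z) \<Rightarrow> k x z) (case v of (x, z) \<Rightarrow> k x z) < \<eta>"
      using compact_uniformly_continuous[OF contk compact_rect] \<eta>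
      unfolding uniformly_continuous_on_def by metis
    define \<delta> where "\<delta> = min (min d1 d2) (min (z - p) (q - z)) / 2"
    have \<delta>: "\<delta> > 0" "\<delta> < d1" "\<delta> < d2" "\<delta> < z - p" "\<delta> < q - z"
      using d1 d2 z by (auto simp: \<delta>_def min_def)
    define e where "e = \<delta> / (b - a)"
    have e: "e > 0" using \<delta> ab by (simp add: e_def)
    have drift: "e * (x - a) \<le> \<delta>" if "x \<in> {a..b}" for x
    proof -
      have "e * (x - a) \<le> e * (b - a)" using that e by (intro mult_left_mono) auto
      also have "\<dots> = \<delta>" using ab by (simp add: e_def)
      finally show ?thesis .
    qed
    (* Points reachable by chains with the required drift and error bounds.
       The set is compact, so a rightmost point exists, and a further step shows that it lies over b.
       The factor 3 collects the error of a step, the linearisation of K, and the variation of k in z. *)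
    define reached where "reached = {v \<in> {a..b} \<times> {p..q}. \<bar>snd v - z\<bar> \<le> e * (fst v - a) \<and>
      \<bar>(case v of (x, z) \<Rightarrow> W x z) - W a z - K (fst v)\<bar> \<le> 3 * \<eta> * (fst v - a)}"
    have contKf: "continuous_on ({a..b} \<times> {p..q}) (\<lambda>v. K (fst v))"
      by (rule continuous_on_compose2[OF K_cont]) (auto intro!: continuous_intros)
    have "closed {v \<in> {a..b} \<times> {p..q}. \<bar>snd v - z\<bar> \<le> e * (fst v - a)}"
      by (intro continuous_on_closed_Collect_le continuous_intros closed_Times; auto)
    moreover have "closed {v \<in> {a..b} \<times> {p..q}.
        \<bar>(case v of (x, z) \<Rightarrow> W x z) - W a z - K (fst v)\<bar> \<le> 3 * \<eta> * (fst v - a)}"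
      by (intro continuous_on_closed_Collect_le continuous_intros closed_Times contW contKf; auto)
    ultimately have "closed reached"
    proof -
      assume 1: "closed {v \<in> {a..b} \<times> {p..q}. \<bar>snd v - z\<bar> \<le> e * (fst v - a)}"
        and 2: "closed {v \<in> {a..b} \<times> {p..q}.
          \<bar>(case v of (x, z) \<Rightarrow> W x z) - W a z - K (fst v)\<bar> \<le> 3 * \<eta> * (fst v - a)}"
      show ?thesis by (rule back_subst[of closed, OF closed_Int[OF 1 2]]) (auto simp: reached_def)
    qed
    moreover have "reached \<subseteq> {a..b} \<times> {p..q}" by (auto simp: reached_def)
    ultimately have "compact reached"
      using compact_rect compact_Int_closed by (metis inf.absorb2)
    then have "compact (fst ` reached)"
      by (intro compact_continuous_image continuous_intros)
    moreover have "(a, z) \<in> reached"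
      using ab z by (auto simp: reached_def K_def)
    then have ne: "fst ` reached \<noteq> {}" by blast
    ultimately obtain s where s: "s \<in> fst ` reached" and smax: "\<And>x. x \<in> fst ` reached \<Longrightarrow> x \<le> s"
      using compact_attains_sup by metis
    then obtain y where y: "(s, y) \<in> reached" by force
    then have sab: "s \<in> {a..b}" and ydrift: "\<bar>y - z\<bar> \<le> e * (s - a)"
      and yW: "\<bar>W s y - W a z - K s\<bar> \<le> 3 * \<eta> * (s - a)"
      by (auto simp: reached_def)
    have y_near: "\<bar>y - z\<bar> \<le> \<delta>" using ydrift drift[OF sab] by linarith
    then have ypq: "p < y" "y < q" using \<delta> by linarith+
    have "s = b"
    proof (rule ccontr)
      assume "s \<noteq> b"
      then have sb: "s < b" using sab by auto
      obtain d where d: "d > 0" and dK: "\<And>x. x \<in> {a..b} \<Longrightarrow> \<bar>x - s\<bar> < d \<Longrightarrow>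
          \<bar>K x - K s - k s z * (x - s)\<bar> \<le> \<eta> * \<bar>x - s\<bar>"
        using has_real_derivative_bound[OF K_deriv[OF sab] \<eta>] by blast
      define e' where "e' = min (min e \<eta>) d"
      have e': "e' > 0" "e' \<le> e" "e' \<le> \<eta>" "e' \<le> d" using e \<eta> d by (auto simp: e'_def)
      obtain x' y' where xy': "s < x'" "x' \<le> b" "x' - s < e'" "\<bar>y' - y\<bar> \<le> e' * (x' - s)"
          "\<bar>W x' y' - W s y - (x' - s) * k s y\<bar> \<le> e' * (x' - s)"
        using step[of s y e'] sab sb ypq e' by auto
      have x'ab: "x' \<in> {a..b}" using xy' sab by auto
      have up: "e' * (x' - s) \<le> e * (x' - s)" "e' * (x' - s) \<le> \<eta> * (x' - s)"
        using e' xy' by (auto intro!: mult_right_mono)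
      have y'drift: "\<bar>y' - z\<bar> \<le> e * (x' - a)"
        using xy' ydrift up by (simp add: algebra_simps)
      have "\<bar>y' - z\<bar> \<le> \<delta>" using y'drift drift[OF x'ab] by linarith
      then have y'pq: "y' \<in> {p..q}" using \<delta> by auto
      have "dist (s, y) (s, z) < d2" using y_near \<delta> by (simp add: dist_Pair_Pair dist_real_def)
      then have "\<bar>k s y - k s z\<bar> < \<eta>"
        using k_uc[of "(s, z)" "(s, y)"] sab ypq z by (auto simp: dist_real_def)
      then have "\<bar>(x' - s) * (k s y - k s z)\<bar> \<le> (x' - s) * \<eta>"
        using xy' by (simp add: abs_mult)
      moreover have "\<bar>K x' - K s - k s z * (x' - s)\<bar> \<le> \<eta> * (x' - s)"
        using dK[OF x'ab] xy' e' by auto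
      ultimately have "\<bar>W x' y' - W a z - K x'\<bar> \<le> 3 * \<eta> * (x' - a)"
        using yW xy' up by (simp add: algebra_simps abs_le_iff)
      then have "(x', y') \<in> reached" using x'ab y'pq y'drift by (auto simp: reached_def)
      then have "x' \<le> s" using smax by force
      then show False using xy' by simp
    qed
    have "dist (b, y) (b, z) < d1" using y_near \<delta> by (simp add: dist_Pair_Pair dist_real_def)
    then have "\<bar>W b y - W b z\<bar> < \<eta>"
      using W_uc[of "(b, z)" "(b, y)"] ab ypq z by (auto simp: dist_real_def)
    then show ?thesis using yW \<open>s = b\<close> by (simp add: algebra_simps abs_le_iff)
  qed
  have lim: "\<bar>W b z - W a z - K b\<bar> \<le> \<eta>" if "\<eta> > 0" for \<eta>
  proof -
    have "1 + 3 * (b - a) > 0" using ab by simp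
    moreover from this have "\<eta> / (1 + 3 * (b - a)) > 0" using that by simp
    ultimately show ?thesis using bound[of "\<eta> / (1 + 3 * (b - a))"] by simp
  qed
  have "\<bar>W b z - W a z - K b\<bar> \<le> 0" by (rule field_le_epsilon) (simp add: lim)
  then show ?thesis by (simp add: K_def)
qed

text \<open>
  A chain rule for differentiating integrals whose limits move with \<open>x\<close>.
\<close>
lemma has_real_derivative_along_curve:
  fixes F :: "real \<Rightarrow> real \<Rightarrow> real"
  assumes fx: "((\<lambda>x. F x (g x0)) has_real_derivative Fx) (at x0 within X)"
    and fy: "\<And>x y. x \<in> X \<Longrightarrow> y \<in> Y \<Longrightarrow> (F x has_real_derivative Fy x y) (at y within Y)"
    and cont: "continuous_on (X \<times> Y) (\<lambda>(x, y). Fy x y)"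
    and g: "(g has_real_derivative g') (at x0 within X)" "\<And>x. x \<in> X \<Longrightarrow> g x \<in> Y"
    and x0: "x0 \<in> X" and Y: "convex Y"
  shows "((\<lambda>x. F x (g x)) has_real_derivative Fx + Fy x0 (g x0) * g') (at x0 within X)"
proof -
  have "((\<lambda>(x, y). F x y) has_derivative
      (\<lambda>(tx, ty). Fx * tx + blinfun_apply (blinfun_mult_right (Fy x0 (g x0))) ty))
      (at (x0, g x0) within X \<times> Y)"
  proof (rule has_derivative_partialsI)
    show "((\<lambda>x. F x (g x0)) has_derivative (*) Fx) (at x0 within X)"
      using fx by (simp add: has_field_derivative_def)
    show "(F x has_derivative blinfun_apply (blinfun_mult_right (Fy x y))) (at y within Y)"
      if "x \<in> X" "y \<in> Y" for x y
      using fy[OF that] by (simp add: has_field_derivative_def)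
    have "continuous_on (X \<times> Y) (\<lambda>v. blinfun_mult_right ((\<lambda>(x, y). Fy x y) v))"
      by (intro bounded_linear.continuous_on[OF bounded_linear_blinfun_mult_right] cont)
    then show "continuous (at (x0, g x0) within X \<times> Y)
        (\<lambda>(x, y). blinfun_mult_right (Fy x y))"
      using x0 g(2)[OF x0] by (auto simp: continuous_on_eq_continuous_within split_def)
  qed (use g x0 Y in auto)
  moreover have "((\<lambda>x. (x, g x)) has_derivative (\<lambda>h. (h, g' * h))) (at x0 within X)"
    using g(1) by (auto intro!: derivative_eq_intros simp: has_field_derivative_def)
  ultimately have "((\<lambda>x. F x (g x)) has_derivative
      (\<lambda>h. Fx * h + Fy x0 (g x0) * (g' * h))) (at x0 within X)"
    using has_derivative_in_compose[of "\<lambda>x. (x, g x)" "\<lambda>h. (h, g' * h)" x0 X "\<lambda>(x, y). F x y"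
        "\<lambda>(tx, ty). Fx * tx + Fy x0 (g x0) * ty"]
      has_derivative_subset[of "\<lambda>(x, y). F x y" _ "(x0, g x0)" "X \<times> Y" "(\<lambda>x. (x, g x)) ` X"] g(2)
    by (auto simp: image_subset_iff)
  moreover have "(\<lambda>h. Fx * h + Fy x0 (g x0) * (g' * h)) = (*) (Fx + Fy x0 (g x0) * g')"
    by (simp add: fun_eq_iff algebra_simps)
  ultimately show ?thesis by (simp add: has_field_derivative_def)
qed

section \<open>The time-integrated wave equation\<close>

text \<open>
  The facts about a \<open>C\<^sup>1\<close>-solution in the interior that the conservation laws rest on. The names \<open>ut\<close>, \<open>ux\<close>
  and \<open>c'\<close> stand for the partial derivatives and for the derivative of \<open>c\<close> outside the closed set \<open>D\<close> of
  possible jumps; the transport equation is stated only in the open quadrant, where its directional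
  derivative is two-sided.
\<close>
locale wave_field =
  fixes V c c' :: "real \<Rightarrow> real" and D :: "real set" and u ut ux :: "real \<Rightarrow> real \<Rightarrow> real"
    and m C :: real
  assumes D_closed: "closed D" and D_finite: "\<And>R. finite (D \<inter> {0..R})"
    and m_pos: "m > 0" and V_lower: "\<And>x. x \<ge> 0 \<Longrightarrow> m \<le> V x"
    and V_upper: "AE x in lborel. 0 \<le> x \<longrightarrow> V x \<le> C"
    and c_def: "\<And>x. x \<ge> 0 \<Longrightarrow> c x = 1 / sqrt (V x)"
    and c_deriv: "\<And>x. x > 0 \<Longrightarrow> x \<notin> D \<Longrightarrow> (c has_real_derivative c' x) (at x)"
    and c'_cont: "continuous_on ({0<..} - D) c'"
    and ut_cont: "continuous_on ({0..} \<times> {0..}) (\<lambda>(x, t). ut x t)"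
    and ux_cont: "continuous_on ({0..} \<times> {0..}) (\<lambda>(x, t). ux x t)"
    and u_deriv_t: "\<And>x t. x \<ge> 0 \<Longrightarrow> t \<ge> 0 \<Longrightarrow>
      ((\<lambda>s. u x s) has_real_derivative ut x t) (at t within {0..})"
    and u_deriv_x: "\<And>x t. x \<ge> 0 \<Longrightarrow> t \<ge> 0 \<Longrightarrow>
      ((\<lambda>y. u y t) has_real_derivative ux x t) (at x within {0..})"
    and transport: "\<And>x t. x > 0 \<Longrightarrow> t > 0 \<Longrightarrow> x \<notin> D \<Longrightarrow>
      ((\<lambda>h. ut (x - c x * h) (t + h) + c (x - c x * h) * ux (x - c x * h) (t + h))
        has_real_derivative - c x * c' x * ux x t) (at 0)"
begin

lemma V_pos: "x \<ge> 0 \<Longrightarrow> V x > 0"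
  using V_lower m_pos by (meson less_le_trans)

lemma c_pos: "x \<ge> 0 \<Longrightarrow> c x > 0"
  using V_pos by (simp add: c_def)

lemma c_nonzero: "x > 0 \<Longrightarrow> c x \<noteq> 0"
  using c_pos[of x] by simp

lemma V_eq: "x \<ge> 0 \<Longrightarrow> V x = 1 / (c x)\<^sup>2"
  using V_pos[of x] by (simp add: c_def power_divide)

lemma c_cont: "continuous_on ({0<..} - D) c"
  by (rule DERIV_continuous_on[of _ c c']) (auto intro: has_field_derivative_at_within c_deriv)

lemma V_cont: "continuous_on ({0<..} - D) V"
proof -
  have "continuous_on ({0<..} - D) (\<lambda>x. 1 / (c x)\<^sup>2)"
    by (intro continuous_intros c_cont) (auto simp: c_nonzero)
  then show ?thesis by (rule continuous_on_eq) (simp add: V_eq)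
qed

lemmas ut_cont' = continuous_on_uncurried[OF ut_cont]
lemmas ux_cont' = continuous_on_uncurried[OF ux_cont]

lemma regular_neighbourhood:
  assumes "x > 0" "x \<notin> D"
  obtains a b where "0 < a" "a < x" "x < b" "{a..b} \<subseteq> {0<..} - D"
proof -
  have "open ({0<..} - D)" using D_closed by (intro open_Diff) auto
  then obtain e where e: "e > 0" "cball x e \<subseteq> {0<..} - D"
    using assms unfolding open_contains_cball by blast
  have "{x - e..x + e} \<subseteq> {0<..} - D" using e(2) by (auto simp: cball_eq_atLeastAtMost)
  moreover from this have "x - e > 0" using e(1) by (auto dest!: subsetD[where c = "x - e"])
  ultimately show ?thesis using that[of "x - e" "x + e"] e(1) by auto
qed

text \<open>
  \<open>Y\<close> is the travel time, so \<open>t = z - Y x\<close> describes a characteristic of slope \<open>dx/dt = - c\<close>. A step of length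
  \<open>r\<close> in \<open>x\<close> along the tangent takes the time \<open>r / c x\<close>, which differs from the increment of \<open>Y\<close> by \<open>o(r)\<close>. This is
  the drift allowed for in \<open>characteristic_integral_of_drifting_steps\<close>. In the parameter \<open>x\<close> the source term
  \<open>- c c' u\<^sub>x\<close> becomes \<open>c' u\<^sub>x\<close>.
\<close>
lemma riemann_invariant_increment:
  assumes a: "0 < a" "a \<le> b" "{a..b} \<subseteq> {0<..} - D"
    and Y: "\<And>x. x \<in> {a..b} \<Longrightarrow> (Y has_real_derivative 1 / c x) (at x within {a..b})"
    and z: "Y b < z"
  shows "(ut b (z - Y b) + c b * ux b (z - Y b)) - (ut a (z - Y a) + c a * ux a (z - Y a)) =
    integral {a..b} (\<lambda>x. c' x * ux x (z - Y x))"
proof (cases "a = b")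
  case False
  then have ab: "a < b" using a by simp
  have Y_cont: "continuous_on {a..b} Y" by (rule DERIV_continuous_on[OF Y])
  have Y_mono: "Y x \<le> Y b" if x: "x \<in> {a..b}" for x
  proof (cases "x = b")
    case False
    then have xb: "x < b" using x by simp
    obtain y where y: "y \<in> {x<..<b}" "Y b - Y x = 1 / c y * (b - x)"
    proof -
      have "(Y has_derivative (*) (1 / c y)) (at y within {x..b})" if "x \<le> y" "y \<le> b" for y
        using has_field_derivative_subset[OF Y, of y "{x..b}"] x that
        by (auto simp: has_field_derivative_def)
      from mvt_simple[OF xb this] show thesis using that by blast
    qed
    then have "Y b - Y x > 0" using c_pos[of y] x a xb by simp
    then show ?thesis by simp
  qed simp
  define p where "p = (Y b + z) / 2"
  have p: "Y b < p" "p < z" using z by (auto simp: p_def)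
  note cc = continuous_on_subset[OF c_cont a(3)] continuous_on_subset[OF c'_cont a(3)]
  have fst_cont: "continuous_on ({a..b} \<times> {p..z+1}) (\<lambda>v. f (fst v))"
    if "continuous_on {a..b} f" for f :: "real \<Rightarrow> real"
    by (rule continuous_on_compose2[OF that]) (auto intro!: continuous_intros)
  have pos: "0 \<le> z' - Y x" if "x \<in> {a..b}" "p \<le> z'" for x z'
    using Y_mono[OF that(1)] p that(2) by linarith
  let ?W = "\<lambda>x z. ut x (z - Y x) + c x * ux x (z - Y x)"
  let ?k = "\<lambda>x z. c' x * ux x (z - Y x)"
  have "?W b z - ?W a z = integral {a..b} (\<lambda>x. ?k x z)"
  proof (rule characteristic_integral_of_drifting_steps[OF ab, of p z "z + 1" ?W ?k])
    show "continuous_on ({a..b} \<times> {p..z + 1}) (\<lambda>(x, z). ?W x z)"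
      unfolding split_def
      by (intro continuous_intros ut_cont' ux_cont' fst_cont cc Y_cont) (use a pos in auto)
    show "continuous_on ({a..b} \<times> {p..z + 1}) (\<lambda>(x, z). ?k x z)"
      unfolding split_def
      by (intro continuous_intros ut_cont' ux_cont' fst_cont cc Y_cont) (use a pos in auto)
    fix x z e :: real
    assume x: "a \<le> x" "x < b" and zp: "p < z" and e: "e > 0"
    define t where "t = z - Y x"
    have "x \<in> {a..b}" using x by simp
    then have xD: "x > 0" "x \<notin> D" "x \<in> {a..b}" using subsetD[OF a(3)] by auto
    have cx: "c x > 0" using c_pos xD by simp
    have t: "t > 0" using Y_mono[OF xD(3)] p zp by (simp add: t_def)
    let ?G = "\<lambda>h. ut (x - c x * h) (t + h) + c (x - c x * h) * ux (x - c x * h) (t + h)"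
    have "\<exists>d1>0. \<forall>h\<in>UNIV. \<bar>h - 0\<bar> < d1 \<longrightarrow>
        \<bar>?G h - ?G 0 - (- c x * c' x * ux x t) * (h - 0)\<bar> \<le> e * c x * \<bar>h - 0\<bar>"
      by (rule has_real_derivative_bound[OF transport[OF xD(1) t xD(2)] mult_pos_pos[OF e cx]])
    then obtain d1 where d1: "d1 > 0" "\<And>h. \<bar>h\<bar> < d1 \<Longrightarrow>
        \<bar>?G h - ?G 0 - (- c x * c' x * ux x t) * h\<bar> \<le> e * c x * \<bar>h\<bar>"
      by (simp only: diff_zero) blast
    obtain d2 where d2: "d2 > 0" "\<And>x'. x' \<in> {a..b} \<Longrightarrow> \<bar>x' - x\<bar> < d2 \<Longrightarrow>
        \<bar>Y x' - Y x - 1 / c x * (x' - x)\<bar> \<le> e * \<bar>x' - x\<bar>"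
      using has_real_derivative_bound[OF Y[OF xD(3)] e] by blast
    define r where "r = min (min (b - x) e) (min d2 (d1 * c x)) / 2"
    have r: "0 < r" "r < b - x" "r < e" "r < d2" "r < d1 * c x"
      using x e d1 d2 cx by (auto simp: r_def min_def)
    define h where "h = - r / c x"
    have h: "\<bar>h\<bar> < d1" "x - c x * h = x + r" "c x * \<bar>h\<bar> = r" "c x * h = - r"
      using r cx by (auto simp: h_def abs_mult field_simps)
    have "\<bar>Y (x + r) - Y x + h\<bar> \<le> e * r"
      using d2(2)[of "x + r"] r x by (simp add: h_def)
    moreover have "\<bar>?W (x + r) (t + h + Y (x + r)) - ?W x z - r * ?k x z\<bar> \<le> e * r"
    proof -
      have "(- c x * c' x * ux x t) * h = - (c x * h) * (c' x * ux x t)" by simp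
      then have "(- c x * c' x * ux x t) * h = r * (c' x * ux x t)" unfolding h(4) by simp
      moreover have "e * c x * \<bar>h\<bar> = e * r" using h(3) by simp
      moreover have "?G h = ?W (x + r) (t + h + Y (x + r))" by (simp only: h(2)) simp
      moreover have "?G 0 = ?W x z" by (simp add: t_def)
      moreover have "?k x z = c' x * ux x t" by (simp add: t_def)
      ultimately show ?thesis using d1(2)[OF h(1)] by presburger
    qed
    ultimately show "\<exists>x' z'. x < x' \<and> x' \<le> b \<and> x' - x < e \<and> \<bar>z' - z\<bar> \<le> e * (x' - x) \<and>
        \<bar>?W x' z' - ?W x z - (x' - x) * ?k x z\<bar> \<le> e * (x' - x)"
      using r 
      by - (rule exI[where x = "x + r"], rule exI[where x = "t + h + Y (x + r)"],
          auto simp: t_def algebra_simps)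
  qed (use p in auto)
  then show ?thesis .
qed simp

lemma riemann_invariant_deriv:
  assumes a: "0 < a" "{a..b} \<subseteq> {0<..} - D"
    and Y: "\<And>x. x \<in> {a..b} \<Longrightarrow> (Y has_real_derivative 1 / c x) (at x within {a..b})"
    and Yz: "\<And>x. x \<in> {a..b} \<Longrightarrow> Y x < z" and x: "x \<in> {a..b}"
  shows "((\<lambda>x. ut x (z - Y x) + c x * ux x (z - Y x)) has_real_derivative
    c' x * ux x (z - Y x)) (at x within {a..b})"
proof -
  have Y_cont: "continuous_on {a..b} Y" by (rule DERIV_continuous_on[OF Y])
  have "continuous_on {a..b} (\<lambda>x. c' x * ux x (z - Y x))"
    by (intro continuous_intros ux_cont' Y_cont continuous_on_subset[OF c'_cont a(2)])
      (use a Yz in \<open>auto simp: less_imp_le\<close>)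
  then have "((\<lambda>x. integral {a..x} (\<lambda>x. c' x * ux x (z - Y x)) + (ut a (z - Y a) + c a * ux a (z - Y a)))
      has_real_derivative c' x * ux x (z - Y x)) (at x within {a..b})"
    using integral_has_real_derivative x by (auto intro!: derivative_eq_intros)
  then show ?thesis
  proof (rule has_field_derivative_transform_within[where d = 1])
    fix y assume y: "y \<in> {a..b}"
    have "(ut y (z - Y y) + c y * ux y (z - Y y)) - (ut a (z - Y a) + c a * ux a (z - Y a)) =
      integral {a..y} (\<lambda>x. c' x * ux x (z - Y x))"
    proof (rule riemann_invariant_increment)
      have sub: "{a..y} \<subseteq> {a..b}" using y by auto
      then show "{a..y} \<subseteq> {0<..} - D" using a(2) by (rule subset_trans)
      show "(Y has_real_derivative 1 / c x) (at x within {a..y})" if "x \<in> {a..y}" for x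
        using that sub by (intro has_field_derivative_subset[OF Y sub]) auto
    qed (use a y Yz in auto)
    then show "integral {a..y} (\<lambda>x. c' x * ux x (z - Y x)) + (ut a (z - Y a) + c a * ux a (z - Y a)) =
      ut y (z - Y y) + c y * ux y (z - Y y)" by simp
  qed (use x in auto)
qed

text \<open>
  With \<open>W x z = w x (z - Y x)\<close>, the integral of \<open>w x\<close> over \<open>[s, t]\<close> is the integral of \<open>W x\<close> over
  \<open>[s + Y x, t + Y x]\<close>. Its derivative consists of \<open>\<integral> c' u\<^sub>x dr\<close> and of the end-point contributions
  \<open>(w(x, t) - w(x, s)) / c\<close>. Dividing \<open>\<integral> w dr - (u(x, t) - u(x, s))\<close> by \<open>c\<close> gives \<open>\<integral> u\<^sub>x dr\<close>, and in its derivative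
  everything cancels except \<open>(u\<^sub>t(x, t) - u\<^sub>t(x, s)) / c\<^sup>2\<close>.
\<close>
lemma time_integrated_flux_deriv_pos:
  assumes x0: "x0 > 0" "x0 \<notin> D" and st: "0 < s" "s \<le> t"
  shows "((\<lambda>x. integral {s..t} (ux x)) has_real_derivative V x0 * (ut x0 t - ut x0 s)) (at x0)"
proof -
  obtain a1 b1 where ab1: "0 < a1" "a1 < x0" "x0 < b1" "{a1..b1} \<subseteq> {0<..} - D"
    using regular_neighbourhood[OF x0] by blast
  define Y where "Y x = integral {a1..x} (\<lambda>x. 1 / c x) - integral {a1..x0} (\<lambda>x. 1 / c x)" for x
  have Y1: "(Y has_real_derivative 1 / c x) (at x within {a1..b1})" if "x \<in> {a1..b1}" for x
  proof -
    have "continuous_on {a1..b1} (\<lambda>x. 1 / c x)"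
      by (intro continuous_intros continuous_on_subset[OF c_cont ab1(4)])
        (use ab1 in \<open>auto simp: c_nonzero\<close>)
    from integral_has_real_derivative[OF this that] show ?thesis
      unfolding Y_def by (auto intro!: derivative_eq_intros)
  qed
  have "continuous (at x0 within {a1..b1}) Y"
    using Y1[of x0] ab1 by (intro DERIV_continuous) auto
  moreover have "x0 \<in> interior {a1..b1}" using ab1 by auto
  ultimately have "isCont Y x0" by (metis at_within_interior)
  then have "\<forall>\<^sub>F x in at x0. dist (Y x) (Y x0) < s / 4"
    using st unfolding isCont_def by (intro tendstoD) auto
  then obtain d where d: "d > 0" "\<And>x. x \<noteq> x0 \<Longrightarrow> dist x x0 < d \<Longrightarrow> dist (Y x) (Y x0) < s / 4"
    unfolding eventually_at by blast
  have Yx0: "Y x0 = 0" by (simp add: Y_def)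
  define a where "a = max a1 (x0 - d / 2)"
  define b where "b = min b1 (x0 + d / 2)"
  have ab: "0 < a" "a < x0" "x0 < b" "{a..b} \<subseteq> {a1..b1}"
    using ab1 d by (auto simp: a_def b_def)
  have abD: "{a..b} \<subseteq> {0<..} - D" using ab(4) ab1(4) by blast
  have Y: "(Y has_real_derivative 1 / c x) (at x within {a..b})" if "x \<in> {a..b}" for x
    using has_field_derivative_subset[OF Y1 ab(4)] that ab(4) by blast
  have Y_cont: "continuous_on {a..b} Y" by (rule DERIV_continuous_on[OF Y])
  have Y_small: "\<bar>Y x\<bar> < s / 4" if "x \<in> {a..b}" for x
  proof (cases "x = x0")
    case True then show ?thesis using st Yx0 by simp
  next
    case False
    have "dist x x0 < d" using that d(1) by (auto simp: dist_real_def a_def b_def)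
    then show ?thesis using d(2)[OF False] Yx0 by (simp add: dist_real_def)
  qed
  (* Near x0 the travel time varies by less than s / 4. The range from z0 to z1 therefore contains
     all end points r + Y x with r between s and t, and the characteristics in it stay at positive times. *)
  define z0 where "z0 = s / 2"
  define z1 where "z1 = t + s / 2"
  have Yz: "Y x < z" if "x \<in> {a..b}" "z0 \<le> z" for x z
    using Y_small[OF that(1)] that(2) st by (simp add: z0_def)
  let ?w = "\<lambda>x t. ut x t + c x * ux x t"
  let ?W = "\<lambda>x z. ?w x (z - Y x)"
  let ?k = "\<lambda>x z. c' x * ux x (z - Y x)"
  have fst_cont: "continuous_on ({a..b} \<times> T) (\<lambda>v. f (fst v))"
    if "continuous_on {a..b} f" for f :: "real \<Rightarrow> real" and T :: "real set"
    by (rule continuous_on_compose2[OF that]) (auto intro!: continuous_intros)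
  note cc = continuous_on_subset[OF c_cont abD] continuous_on_subset[OF c'_cont abD]
  have W_cont: "continuous_on ({a..b} \<times> {z0..z1}) (\<lambda>(x, z). ?W x z)"
    unfolding split_def
    by (intro continuous_intros ut_cont' ux_cont' fst_cont cc Y_cont) (use ab Yz in \<open>auto simp: less_imp_le\<close>)
  have k_cont: "continuous_on ({a..b} \<times> {z0..z1}) (\<lambda>(x, z). ?k x z)"
    unfolding split_def
    by (intro continuous_intros ut_cont' ux_cont' fst_cont cc Y_cont) (use ab Yz in \<open>auto simp: less_imp_le\<close>)
  have W_cont1: "continuous_on {z0..z1} (?W x)" if "x \<in> {a..b}" for x
    by (rule continuous_on_uncurried[OF W_cont]) (use that in \<open>auto intro!: continuous_intros\<close>)
  define P where "P x v = integral {z0..v} (?W x)" for x v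
  have P_v: "(P x has_real_derivative ?W x v) (at v within {z0..z1})"
    if "x \<in> {a..b}" "v \<in> {z0..z1}" for x v
    unfolding P_def by (rule integral_has_real_derivative[OF W_cont1[OF that(1)] that(2)])
  have P_x: "((\<lambda>x. P x v) has_real_derivative integral {z0..v} (?k x)) (at x within {a..b})"
    if "x \<in> {a..b}" "v \<in> {z0..z1}" for x v
    unfolding P_def box_real[symmetric]
  proof (rule leibniz_rule_field_derivative)
    fix x z assume xz: "x \<in> cbox a b" "z \<in> cbox z0 v"
    show "((\<lambda>x. ?W x z) has_real_derivative ?k x z) (at x within cbox a b)"
      using riemann_invariant_deriv[OF ab(1) abD Y Yz] xz by auto
  next
    fix x assume "x \<in> cbox a b"
    then have "continuous_on (cbox z0 v) (?W x)"
      using continuous_on_subset[OF W_cont1] that by auto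
    then show "?W x integrable_on cbox z0 v" by (rule integrable_continuous)
  next
    show "continuous_on (cbox a b \<times> cbox z0 v) (\<lambda>(x, z). ?k x z)"
      by (rule continuous_on_subset[OF k_cont]) (use that in auto)
  qed (use that in auto)
  have P_curve: "((\<lambda>x. P x (r + Y x)) has_real_derivative
      integral {z0..r} (?k x0) + ?w x0 r * (1 / c x0)) (at x0 within {a..b})"
    if r: "s \<le> r" "r \<le> t" for r
  proof -
    have "((\<lambda>x. P x (r + Y x)) has_real_derivative
        integral {z0..r} (?k x0) + ?W x0 (r + Y x0) * (1 / c x0)) (at x0 within {a..b})"
    proof (rule has_real_derivative_along_curve[of P "\<lambda>x. r + Y x" x0 _ "{a..b}" "{z0..z1}" ?W])
      show "((\<lambda>x. P x (r + Y x0)) has_real_derivative integral {z0..r} (?k x0)) (at x0 within {a..b})"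
        using P_x[of x0 r] ab r st by (simp add: Yx0 z0_def z1_def)
      show "r + Y x \<in> {z0..z1}" if "x \<in> {a..b}" for x
        using Y_small[OF that] r st by (auto simp: z0_def z1_def)
      show "((\<lambda>x. r + Y x) has_real_derivative 1 / c x0) (at x0 within {a..b})"
        using Y[of x0] ab by (auto intro!: derivative_eq_intros)
    qed (use P_v W_cont ab in auto)
    then show ?thesis by (simp add: Yx0)
  qed
  have x0_int: "at x0 within {a..b} = at x0"
    using ab by (intro at_within_interior) auto
  define \<Phi> where "\<Phi> = integral {s..t} (ux x0)"
  have \<Phi>_k: "integral {z0..t} (?k x0) - integral {z0..s} (?k x0) = c' x0 * \<Phi>"
  proof -
    have "continuous_on {z0..t} (?k x0)"
      by (rule continuous_on_uncurried[OF k_cont])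
        (use ab st in \<open>auto intro!: continuous_intros simp: z1_def\<close>)
    then have "integral {z0..s} (?k x0) + integral {s..t} (?k x0) = integral {z0..t} (?k x0)"
      using st by (intro Henstock_Kurzweil_Integration.integral_combine integrable_continuous_real)
        (auto simp: z0_def)
    then show ?thesis by (simp add: Yx0 \<Phi>_def)
  qed
  have integrals: "ux x integrable_on {s..t}" "ut x integrable_on {s..t}"
    "integral {s..t} (ut x) = u x t - u x s" if "x > 0" for x
  proof -
    show "ux x integrable_on {s..t}"
      by (intro integrable_continuous_real ux_cont') (use st that in \<open>auto intro!: continuous_intros\<close>)
    have "(ut x has_integral u x t - u x s) {s..t}"
      by (intro fundamental_theorem_of_calculus)
        (use st that in \<open>auto intro!: has_field_derivative_subset[OF u_deriv_t]
          simp: has_real_derivative_iff_has_vector_derivative[symmetric]\<close>)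
    then show "ut x integrable_on {s..t}" "integral {s..t} (ut x) = u x t - u x s"
      by (auto simp: has_integral_integrable integral_unique)
  qed
  have flux: "(P x (t + Y x) - P x (s + Y x) - (u x t - u x s)) / c x = integral {s..t} (ux x)"
    if x: "x \<in> {a..b}" for x
  proof -
    have x_pos: "x > 0" "c x > 0" using x ab c_pos[of x] by auto
    have "continuous_on {z0..t + Y x} (?W x)"
      using Y_small[OF x] st
      by (intro continuous_on_subset[OF W_cont1[OF x]]) (auto simp: z1_def)
    then have "P x (s + Y x) + integral {s + Y x..t + Y x} (?W x) = P x (t + Y x)"
      unfolding P_def using Y_small[OF x] st
      by (intro Henstock_Kurzweil_Integration.integral_combine integrable_continuous_real)
        (auto simp: z0_def)
    moreover have "integral {s + Y x..t + Y x} (?W x) = integral {s..t} (?w x)"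
      using integral_shift_real_ivl[of "s + Y x" "Y x" "t + Y x" "?W x"] by simp
    moreover have "integral {s..t} (?w x) = (u x t - u x s) + c x * integral {s..t} (ux x)"
      using integrals[OF x_pos(1)] by (simp add: integral_add integrable_on_mult_right)
    ultimately show ?thesis using x_pos by (simp add: field_simps)
  qed
  have u_x: "((\<lambda>x. u x r) has_real_derivative ux x0 r) (at x0)" if "r \<ge> 0" for r
  proof -
    have "at x0 within {0..} = at x0" using x0 by (intro at_within_interior) (auto simp: interior_real_atLeast)
    then show ?thesis using u_deriv_x[of x0 r] x0 that by simp
  qed
  have c0: "c x0 > 0" using c_pos x0 by simp
  have "((\<lambda>x. (P x (t + Y x) - P x (s + Y x) - (u x t - u x s)) / c x) has_real_derivative
      ((integral {z0..t} (?k x0) + ?w x0 t * (1 / c x0) - (integral {z0..s} (?k x0) + ?w x0 s * (1 / c x0))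
        - (ux x0 t - ux x0 s)) * c x0
       - (P x0 (t + Y x0) - P x0 (s + Y x0) - (u x0 t - u x0 s)) * c' x0) / (c x0 * c x0)) (at x0)"
    using c0 st
    by (intro derivative_intros P_curve[unfolded x0_int] u_x c_deriv x0) auto
  moreover have "(P x0 (t + Y x0) - P x0 (s + Y x0) - (u x0 t - u x0 s)) = c x0 * \<Phi>"
    using flux[of x0] ab c0 by (simp add: \<Phi>_def field_simps)
  moreover have "integral {z0..t} (?k x0) = c' x0 * \<Phi> + integral {z0..s} (?k x0)"
    using \<Phi>_k by simp
  moreover have "((c' x0 * \<Phi> + I + ?w x0 t * (1 / c x0) - (I + ?w x0 s * (1 / c x0))
        - (ux x0 t - ux x0 s)) * c x0 - (c x0 * \<Phi>) * c' x0) / (c x0 * c x0) =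
      V x0 * (ut x0 t - ut x0 s)" for I
    unfolding V_eq[OF less_imp_le[OF x0(1)]] using c0 by (simp add: field_simps power2_eq_square)
  ultimately have "((\<lambda>x. (P x (t + Y x) - P x (s + Y x) - (u x t - u x s)) / c x)
      has_real_derivative V x0 * (ut x0 t - ut x0 s)) (at x0)"
    by simp
  then show ?thesis
    by (rule has_field_derivative_transform_within_open[where S = "{a<..<b}"])
      (use ab flux in auto)
qed

text \<open>
  The transport derivative is two-sided at positive times only, so the start time \<open>0\<close> is reached as a limit:
  both sides of the equation, integrated over \<open>[a, x]\<close>, are continuous in \<open>s\<close>.
\<close>
lemma time_integrated_flux_deriv:
  assumes x0: "x0 > 0" "x0 \<notin> D" and st: "0 \<le> s" "s \<le> t"
  shows "((\<lambda>x. integral {s..t} (ux x)) has_real_derivative V x0 * (ut x0 t - ut x0 s)) (at x0)"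
proof (cases "s = 0 \<and> s < t")
  case True
  then have s: "s = 0" "t > 0" by auto
  obtain a b where ab: "0 < a" "a < x0" "x0 < b" "{a..b} \<subseteq> {0<..} - D"
    using regular_neighbourhood[OF x0] by blast
  have V_cont_ab: "continuous_on {a..b} V" using continuous_on_subset[OF V_cont ab(4)] .
  have ux_int: "ux x integrable_on {0..t}" if "x \<in> {a..b}" for x
    by (intro integrable_continuous_real ux_cont') (use that ab in \<open>auto intro!: continuous_intros\<close>)
  have eq: "integral {a..x} (\<lambda>y. V y * (ut y t - ut y 0)) - (integral {0..t} (ux x) - integral {0..t} (ux a)) = 0"
    if x: "x \<in> {a..b}" for x
  proof -
    have V_cont_ax: "continuous_on {a..x} V"
      using continuous_on_subset[OF V_cont_ab] x by auto
    define g where "g s = integral {a..x} (\<lambda>y. V y * (ut y t - ut y s)) -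
      (integral {s..t} (ux x) - integral {s..t} (ux a))" for s
    have "continuous_on ({0..t} \<times> cbox a x) (\<lambda>(s, y). V y * (ut y t - ut y s))"
      unfolding split_def
      by (intro continuous_intros ut_cont' continuous_on_compose2[OF V_cont_ax]) (use ab x s in auto)
    then have "continuous_on {0..t} (\<lambda>s. integral (cbox a x) (\<lambda>y. V y * (ut y t - ut y s)))"
      by (rule integral_continuous_on_param)
    then have "continuous_on {0..t} g"
      unfolding g_def using ux_int[OF x] ux_int[of a] ab
      by (intro continuous_intros indefinite_integral_continuous_1') auto
    moreover have "g s = 0" if "s \<in> {0<..t}" for s
    proof -
      have "((\<lambda>y. V y * (ut y t - ut y s)) has_integral
          (integral {s..t} (ux x) - integral {s..t} (ux a))) {a..x}"
      proof (rule fundamental_theorem_of_calculus)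
        fix y assume "y \<in> {a..x}"
        then have "y \<in> {a..b}" using x by auto
        then have "y > 0" "y \<notin> D" using subsetD[OF ab(4)] by auto
        then show "((\<lambda>x. integral {s..t} (ux x)) has_vector_derivative V y * (ut y t - ut y s))
            (at y within {a..x})"
          unfolding has_real_derivative_iff_has_vector_derivative[symmetric]
          using that by (intro has_field_derivative_at_within[OF time_integrated_flux_deriv_pos]) auto
      qed (use x in auto)
      then show ?thesis by (simp add: g_def integral_unique)
    qed
    moreover have "closure {0<..t} = {0..t}" using s by simp
    ultimately have "g 0 = 0"
      using continuous_constant_on_closure[of "{0<..t}" g 0 0] s by auto
    then show ?thesis by (simp add: g_def)
  qed
  have "continuous_on {a..b} (\<lambda>y. V y * (ut y t - ut y 0))"
    by (intro continuous_intros V_cont_ab ut_cont') (use ab s in auto)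
  then have "((\<lambda>x. integral {a..x} (\<lambda>y. V y * (ut y t - ut y 0)) + integral {0..t} (ux a))
      has_real_derivative V x0 * (ut x0 t - ut x0 0)) (at x0 within {a..b})"
    using integral_has_real_derivative[of a b _ x0] ab by (auto intro!: derivative_eq_intros)
  moreover have "at x0 within {a..b} = at x0"
    using ab by (intro at_within_interior) auto
  ultimately have "((\<lambda>x. integral {a..x} (\<lambda>y. V y * (ut y t - ut y 0)) + integral {0..t} (ux a))
      has_real_derivative V x0 * (ut x0 t - ut x0 0)) (at x0)" by simp
  then show ?thesis
    unfolding s(1)
    by (rule has_field_derivative_transform_within_open[where S = "{a<..<b}"])
      (use ab eq in \<open>auto simp: algebra_simps\<close>)
next
  case False
  then show ?thesis
    using time_integrated_flux_deriv_pos[OF x0, of s t] st by (cases "s = t") auto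
qed

end

section \<open>Energy inequality for weighted energies\<close>
definition forward_mean :: "real \<Rightarrow> (real \<Rightarrow> real) \<Rightarrow> real \<Rightarrow> real" where
  "forward_mean h f t = integral {t..t + h} f / h"

lemma antiderivative_half_line:
  fixes f :: "real \<Rightarrow> real"
  assumes f: "continuous_on {0..} f" and v: "v \<ge> 0"
  shows "((\<lambda>v. integral {0..v} f) has_real_derivative f v) (at v within {0..})"
proof -
  have "((\<lambda>v. integral {0..v} f) has_real_derivative f v) (at v within {0..v + 1})"
    using v by (intro integral_has_real_derivative continuous_on_subset[OF f]) auto
  moreover have "at v within {0..v + 1} = at v within {0..}"
    by (rule at_within_nhd[where S = "{v - 1<..<v + 1}"]) auto
  ultimately show ?thesis by simp
qed

lemma forward_mean_deriv:
  assumes f: "continuous_on {0..} f" and "t \<ge> 0" "h > 0"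
  shows "(forward_mean h f has_real_derivative (f (t + h) - f t) / h) (at t within {0..})"
proof -
  let ?I = "\<lambda>v. integral {0..v} f"
  have shift: "((\<lambda>t. t + h) has_real_derivative 1) (at t within {0..})"
    by (auto intro!: derivative_eq_intros)
  have "(?I has_real_derivative f (t + h)) (at (t + h) within (\<lambda>t. t + h) ` {0..})"
    by (rule has_field_derivative_subset[OF antiderivative_half_line[OF f]]) (use assms in auto)
  from DERIV_image_chain[OF this shift]
  have "((\<lambda>t. ?I (t + h)) has_real_derivative f (t + h)) (at t within {0..})"
    by (simp add: o_def)
  then have "((\<lambda>t. (?I (t + h) - ?I t) / h) has_real_derivative (f (t + h) - f t) / h) (at t within {0..})"
    using antiderivative_half_line[OF f assms(2)] by (intro DERIV_cdivide derivative_intros)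
  then show ?thesis
  proof (rule has_field_derivative_transform_within[where d = 1])
    fix t :: real assume "t \<in> {0..}"
    then have "?I t + integral {t..t + h} f = ?I (t + h)"
      using assms
      by (intro Henstock_Kurzweil_Integration.integral_combine integrable_continuous_real
          continuous_on_subset[OF f]) auto
    then show "(?I (t + h) - ?I t) / h = forward_mean h f t"
      by (simp add: forward_mean_def)
  qed (use assms in auto)
qed

lemma forward_mean_bound:
  assumes f: "continuous_on {t..t + h} f" and h: "h > 0"
    and B: "\<And>s. s \<in> {t..t + h} \<Longrightarrow> \<bar>f s\<bar> \<le> B"
  shows "\<bar>forward_mean h f t\<bar> \<le> B"
proof -
  have "norm (integral {t..t + h} f) \<le> B * (t + h - t)"
    by (rule integral_bound) (use assms in auto)
  then show ?thesis using h by (simp add: forward_mean_def field_simps)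
qed

lemma forward_mean_tendsto:
  assumes f: "continuous_on {0..} f" and "t \<ge> 0"
  shows "(\<lambda>n. forward_mean (inverse (real (Suc n))) f t) \<longlonglongrightarrow> f t"
proof -
  let ?h = "\<lambda>n. inverse (real (Suc n))"
  let ?I = "\<lambda>v. integral {t..v} f"
  have "(?I has_real_derivative f t) (at t within {t..t + 1})"
    using assms by (intro integral_has_real_derivative continuous_on_subset[OF f]) auto
  then have lim: "((\<lambda>v. (?I v - ?I t) / (v - t)) \<longlongrightarrow> f t) (at t within {t..t + 1})"
    by (simp add: has_field_derivative_iff)
  have "(\<lambda>n. t + ?h n) \<longlonglongrightarrow> t + 0"
    by (intro tendsto_intros LIMSEQ_inverse_real_of_nat)
  then have "filterlim (\<lambda>n. t + ?h n) (at t within {t..t + 1}) sequentially"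
    by (auto simp: filterlim_at field_simps)
  from filterlim_compose[OF lim this] show ?thesis
    by (simp add: forward_mean_def)
qed

context wave_field begin

lemma ut_cont_t: "x \<ge> 0 \<Longrightarrow> continuous_on {0..} (ut x)"
  by (intro ut_cont' continuous_intros) auto

lemma ux_cont_t: "x \<ge> 0 \<Longrightarrow> continuous_on {0..} (ux x)"
  by (intro ux_cont' continuous_intros) auto

lemma forward_mean_ut:
  assumes "x \<ge> 0" "t \<ge> 0" "h > 0"
  shows "forward_mean h (ut x) t = (u x (t + h) - u x t) / h"
proof -
  have "(ut x has_integral u x (t + h) - u x t) {t..t + h}"
    by (intro fundamental_theorem_of_calculus)
      (use assms in \<open>auto intro!: has_field_derivative_subset[OF u_deriv_t]
        simp: has_real_derivative_iff_has_vector_derivative[symmetric]\<close>)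
  then show ?thesis by (simp add: forward_mean_def integral_unique)
qed

lemma forward_mean_cont:
  assumes f: "continuous_on ({0..} \<times> {0..}) (\<lambda>(x, t). f x t)" and h: "h > 0"
  shows "continuous_on ({0..} \<times> {0..}) (\<lambda>(x, t). forward_mean h (f x) t)"
proof -
  have "continuous_on (({0..} \<times> {0..}) \<times> cbox 0 h) (\<lambda>(v, r). f (fst v) (r + snd v))"
    unfolding split_def
    by (rule continuous_on_uncurried[OF f]) (auto intro!: continuous_intros)
  then have "continuous_on ({0..} \<times> {0..}) (\<lambda>v. integral (cbox 0 h) (\<lambda>r. f (fst v) (r + snd v)))"
    by (rule integral_continuous_on_param)
  then have "continuous_on ({0..} \<times> {0..}) (\<lambda>v. integral (cbox 0 h) (\<lambda>r. f (fst v) (r + snd v)) / h)"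
    using h by (intro continuous_intros) auto
  moreover have "integral (cbox 0 h) (\<lambda>r. f x (r + t)) / h = forward_mean h (f x) t" for x t
    using integral_shift_real_ivl[of t t "t + h" "f x"] by (simp add: forward_mean_def add.commute)
  ultimately show ?thesis by (simp add: split_def)
qed

lemma V_measurable: "(\<lambda>x. indicator {0..} x * V x) \<in> borel_measurable borel"
proof (rule measurable_discrete_difference)
  have "(\<lambda>x. indicator ({0<..} - D) x *\<^sub>R V x) \<in> borel_measurable borel"
    using D_closed by (intro borel_measurable_continuous_on_indicator V_cont) auto
  then show "(\<lambda>x. indicator ({0<..} - D) x * V x) \<in> borel_measurable borel" by simp
  have "D \<inter> {0..} = (\<Union>n::nat. D \<inter> {0..real n})"
    by (auto simp: real_arch_simple)
  moreover have "countable (\<Union>n::nat. D \<inter> {0..real n})"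
    by (rule countable_UN) (auto intro: countable_finite D_finite)
  ultimately show "countable (insert 0 (D \<inter> {0..}))" by simp
qed (auto simp: indicator_def)

lemma V_times_integrable:
  assumes a: "0 \<le> a" and g: "continuous_on {a..b} g"
  shows "set_integrable lborel {a..b} (\<lambda>x. V x * g x)" "(\<lambda>x. V x * g x) integrable_on {a..b}"
proof -
  have "bounded (g ` {a..b})"
    using g by (intro compact_imp_bounded compact_continuous_image) auto
  then obtain B where B: "\<And>x. x \<in> {a..b} \<Longrightarrow> \<bar>g x\<bar> \<le> B"
    unfolding bounded_iff by (metis imageI real_norm_def)
  let ?F = "\<lambda>x. (indicator {0..} x * V x) * (indicator {a..b} x *\<^sub>R g x)"
  have "integrable lborel (\<lambda>x. indicator {a..b} x *\<^sub>R ?F x)"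
  proof (rule integrableI_bounded_set_indicator)
    have "(\<lambda>x. indicator {a..b} x *\<^sub>R g x) \<in> borel_measurable borel"
      by (intro borel_measurable_continuous_on_indicator g) auto
    then show "?F \<in> borel_measurable lborel"
      using V_measurable by simp
    show "AE x in lborel. x \<in> {a..b} \<longrightarrow> norm (?F x) \<le> C * B"
      using V_upper
    proof (eventually_elim, intro impI)
      fix x assume V: "0 \<le> x \<longrightarrow> V x \<le> C" and x: "x \<in> {a..b}"
      then have "0 \<le> x" using a by simp
      then have "\<bar>V x\<bar> \<le> C" using V V_pos[of x] by simp
      moreover have "\<bar>V x\<bar> * \<bar>g x\<bar> \<le> C * B"
        using calculation B[OF x] by (intro mult_mono) auto
      ultimately show "norm (?F x) \<le> C * B" using x \<open>0 \<le> x\<close> by (simp add: abs_mult)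
    qed
  qed (auto simp: emeasure_lborel_Icc_eq)
  moreover have "(\<lambda>x. indicator {a..b} x *\<^sub>R ?F x) = (\<lambda>x. indicator {a..b} x *\<^sub>R (V x * g x))"
    using a by (auto simp: indicator_def fun_eq_iff)
  ultimately show 1: "set_integrable lborel {a..b} (\<lambda>x. V x * g x)"
    unfolding set_integrable_def by (simp only:)
  then show "(\<lambda>x. V x * g x) integrable_on {a..b}"
    by (rule set_borel_integral_eq_integral(1))
qed

text \<open>
  The energy flux \<open>p q\<close> is at most \<open>1 / sqrt m\<close> times the energy density, that is, energy travels at speed at
  most \<open>1 / sqrt m\<close>. A weight that decreases in time at least as fast as its spatial slope demands
  therefore loses at least as much energy as the flux can bring in.
\<close>
lemma density_dominates_flux:
  assumes x: "x \<ge> 0" and \<omega>: "1 / sqrt m * \<bar>\<omega>x\<bar> \<le> - \<omega>t"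
  shows "\<omega>t * ((V x * p\<^sup>2 + q\<^sup>2) / 2) \<le> \<omega>x * (p * q)"
proof -
  have m: "sqrt m > 0" using m_pos by simp
  have "2 * sqrt m * \<bar>p * q\<bar> \<le> m * p\<^sup>2 + q\<^sup>2"
    using sum_squares_bound[of "sqrt m * \<bar>p\<bar>" "\<bar>q\<bar>"] m_pos
    by (simp add: power_mult_distrib abs_mult mult_ac)
  also have "\<dots> \<le> V x * p\<^sup>2 + q\<^sup>2"
    using V_lower[OF x] by (simp add: mult_right_mono)
  finally have *: "\<bar>p * q\<bar> * sqrt m \<le> (V x * p\<^sup>2 + q\<^sup>2) / 2" by (simp add: mult_ac)
  have "\<bar>\<omega>x\<bar> * \<bar>p * q\<bar> = (1 / sqrt m * \<bar>\<omega>x\<bar>) * (\<bar>p * q\<bar> * sqrt m)"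
    using m by simp
  also have "\<dots> \<le> (- \<omega>t) * ((V x * p\<^sup>2 + q\<^sup>2) / 2)"
  proof (rule mult_mono[OF \<omega> *])
    have "0 \<le> 1 / sqrt m * \<bar>\<omega>x\<bar>" using m by simp
    then show "0 \<le> - \<omega>t" using \<omega> by linarith
  qed (use m in simp)
  finally have "\<bar>\<omega>x * (p * q)\<bar> \<le> - (\<omega>t * ((V x * p\<^sup>2 + q\<^sup>2) / 2))" by (simp add: abs_mult)
  then show ?thesis by linarith
qed

end

locale weighted_wave_field = wave_field +
  fixes \<omega> \<omega>x \<omega>t :: "real \<Rightarrow> real \<Rightarrow> real"
  assumes \<omega>_deriv_x: "\<And>x t. ((\<lambda>x. \<omega> x t) has_real_derivative \<omega>x x t) (at x)"
    and \<omega>_deriv_t: "\<And>x t. (\<omega> x has_real_derivative \<omega>t x t) (at t)"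
    and \<omega>_cont: "continuous_on UNIV (\<lambda>(x, t). \<omega> x t)"
    and \<omega>x_cont: "continuous_on UNIV (\<lambda>(x, t). \<omega>x x t)"
    and \<omega>t_cont: "continuous_on UNIV (\<lambda>(x, t). \<omega>t x t)"
begin

lemmas \<omega>_cont' = continuous_on_uncurried[OF \<omega>_cont]
lemmas \<omega>x_cont' = continuous_on_uncurried[OF \<omega>x_cont]
lemmas \<omega>t_cont' = continuous_on_uncurried[OF \<omega>t_cont]

text \<open>
  The inequality is obtained by treating \<open>x\<close> as the evolution variable: the time integral of \<open>\<omega> p q\<close> is
  differentiated in \<open>x\<close>. At a fixed \<open>x\<close> outside \<open>D\<close> the function \<open>V\<close> is continuous nearby, so differentiation
  under the integral sign is unproblematic, whereas differentiating \<open>\<integral> V p\<^sup>2 dx\<close> in time would have to cope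
  with the jumps of \<open>V\<close>. The system \<open>p\<^sub>x = q\<^sub>t\<close>, \<open>q\<^sub>x = V p\<^sub>t\<close> turns the derivative into the increment of the
  weighted density plus \<open>\<integral> (\<omega>\<^sub>x p q - \<omega>\<^sub>t e) dt \<ge> 0\<close>.
\<close>
lemma averaged_energy_inequality:
  fixes h
  defines "p \<equiv> \<lambda>x. forward_mean h (ut x)" and "q \<equiv> \<lambda>x. forward_mean h (ux x)"
  assumes h: "h > 0" and t: "0 \<le> t1" "t1 \<le> t2" and R: "0 \<le> R"
    and slope: "\<And>x t. x \<in> {0..R} \<Longrightarrow> t \<in> {t1..t2} \<Longrightarrow> 1 / sqrt m * \<bar>\<omega>x x t\<bar> \<le> - \<omega>t x t"
  shows "integral {0..R} (\<lambda>x. \<omega> x t2 * ((V x * (p x t2)\<^sup>2 + (q x t2)\<^sup>2) / 2)) -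
      integral {0..R} (\<lambda>x. \<omega> x t1 * ((V x * (p x t1)\<^sup>2 + (q x t1)\<^sup>2) / 2)) \<le>
    integral {t1..t2} (\<lambda>t. \<omega> R t * (p R t * q R t)) -
      integral {t1..t2} (\<lambda>t. \<omega> 0 t * (p 0 t * q 0 t))"
proof -
  have p_cont: "continuous_on ({0..} \<times> {0..}) (\<lambda>(x, t). p x t)"
    and q_cont: "continuous_on ({0..} \<times> {0..}) (\<lambda>(x, t). q x t)"
    unfolding p_def q_def using h by (intro forward_mean_cont ut_cont ux_cont; simp)+
  note p_cont' = continuous_on_uncurried[OF p_cont] and q_cont' = continuous_on_uncurried[OF q_cont]
  define pt where "pt x t = (ut x (t + h) - ut x t) / h" for x t
  define px where "px x t = (ux x (t + h) - ux x t) / h" for x t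
  have p_t: "(p x has_real_derivative pt x t) (at t within {0..})" if "x \<ge> 0" "t \<ge> 0" for x t
    unfolding p_def pt_def using that h by (intro forward_mean_deriv ut_cont_t)
  have q_t: "(q x has_real_derivative px x t) (at t within {0..})" if "x \<ge> 0" "t \<ge> 0" for x t
    unfolding q_def px_def using that h by (intro forward_mean_deriv ux_cont_t)
  have p_x: "((\<lambda>x. p x t) has_real_derivative px x t) (at x)" if "x > 0" "t \<ge> 0" for x t
  proof -
    have x_int: "at x within {0..} = at x"
      using that by (intro at_within_interior) (auto simp: interior_real_atLeast)
    have "((\<lambda>x. (u x (t + h) - u x t) / h) has_real_derivative px x t) (at x)"
      unfolding px_def using u_deriv_x[of x t] u_deriv_x[of x "t + h"] that h x_int
      by (intro DERIV_cdivide derivative_intros) auto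
    then show ?thesis
      by (rule has_field_derivative_transform_within_open[where S = "{0<..}"])
        (use that h in \<open>auto simp: p_def forward_mean_ut\<close>)
  qed
  have q_x: "((\<lambda>x. q x t) has_real_derivative V x * pt x t) (at x)"
    if "x > 0" "x \<notin> D" "t \<ge> 0" for x t
    using DERIV_cdivide[OF time_integrated_flux_deriv[of x t "t + h"], of h] that h
    by (simp add: q_def pt_def forward_mean_def)
  have pt_cont: "continuous_on A (\<lambda>v. pt (f v) (g v))" and px_cont: "continuous_on A (\<lambda>v. px (f v) (g v))"
    if "continuous_on A f" "continuous_on A g" "\<And>v. v \<in> A \<Longrightarrow> 0 \<le> f v" "\<And>v. v \<in> A \<Longrightarrow> 0 \<le> g v"
    for A :: "'b::topological_space set" and f g
    unfolding pt_def px_def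
    by (intro continuous_intros ut_cont' ux_cont' that; use that h in force)+
  let ?e = "\<lambda>x t. (V x * (p x t)\<^sup>2 + (q x t)\<^sup>2) / 2"
  define Q where "Q x = integral {t1..t2} (\<lambda>t. \<omega> x t * (p x t * q x t))" for x
  define Q'i where "Q'i x t = \<omega>x x t * (p x t * q x t) +
      \<omega> x t * (px x t * q x t + p x t * (V x * pt x t))" for x t
  have Q_deriv: "(Q has_real_derivative integral {t1..t2} (Q'i x0)) (at x0)"
    if x0: "x0 > 0" "x0 \<notin> D" for x0
  proof -
    obtain a b where ab: "0 < a" "a < x0" "x0 < b" "{a..b} \<subseteq> {0<..} - D"
      using regular_neighbourhood[OF x0] by blast
    have Vc: "continuous_on ({a..b} \<times> {t1..t2}) (\<lambda>v. V (fst v))"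
      by (rule continuous_on_compose2[OF continuous_on_subset[OF V_cont ab(4)]])
        (auto intro!: continuous_intros)
    have "((\<lambda>x. integral (cbox t1 t2) (\<lambda>t. \<omega> x t * (p x t * q x t))) has_real_derivative
        integral (cbox t1 t2) (Q'i x0)) (at x0 within {a..b})"
    proof (rule leibniz_rule_field_derivative)
      fix x t assume x: "x \<in> {a..b}" and t': "t \<in> cbox t1 t2"
      have "x > 0" "x \<notin> D" "t \<ge> 0" using x t' t subsetD[OF ab(4) x] by auto
      then have "((\<lambda>x. \<omega> x t * (p x t * q x t)) has_real_derivative Q'i x t) (at x)"
        unfolding Q'i_def
        by (auto intro!: derivative_eq_intros p_x q_x \<omega>_deriv_x simp: algebra_simps)
      then show "((\<lambda>x. \<omega> x t * (p x t * q x t)) has_real_derivative Q'i x t) (at x within {a..b})"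
        by (rule has_field_derivative_at_within)
    next
      fix x assume "x \<in> {a..b}"
      then have "continuous_on (cbox t1 t2) (\<lambda>t. \<omega> x t * (p x t * q x t))"
        using ab t by (intro continuous_intros p_cont' q_cont' \<omega>_cont') auto
      then show "(\<lambda>t. \<omega> x t * (p x t * q x t)) integrable_on cbox t1 t2"
        by (rule integrable_continuous)
    next
      show "continuous_on ({a..b} \<times> cbox t1 t2) (\<lambda>(x, t). Q'i x t)"
        unfolding Q'i_def split_def box_real using ab t
        by (intro continuous_intros p_cont' q_cont' pt_cont px_cont \<omega>_cont' \<omega>x_cont' Vc) auto
    qed (use ab in auto)
    moreover have "at x0 within {a..b} = at x0"
      using ab by (intro at_within_interior) auto
    ultimately show ?thesis by (simp add: Q_def[abs_def])
  qed
  have Q_cont: "continuous_on {0..R} Q"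
  proof -
    have "continuous_on ({0..R} \<times> cbox t1 t2) (\<lambda>(x, t). \<omega> x t * (p x t * q x t))"
      unfolding split_def using t by (intro continuous_intros p_cont' q_cont' \<omega>_cont') auto
    from integral_continuous_on_param[OF this] show ?thesis by (simp add: Q_def[abs_def])
  qed
  have Q'_integral: "((\<lambda>x. integral {t1..t2} (Q'i x)) has_integral (Q R - Q 0)) {0..R}"
  proof (rule fundamental_theorem_of_calculus_interior_strong[OF D_finite[of R] R _ Q_cont])
    fix x assume "x \<in> {0<..<R} - D \<inter> {0..R}"
    then show "(Q has_vector_derivative integral {t1..t2} (Q'i x)) (at x)"
      using Q_deriv[of x] by (auto simp: has_real_derivative_iff_has_vector_derivative)
  qed
  have e_int: "(\<lambda>x. \<omega> x s * ?e x s) integrable_on {0..R}" if "s \<ge> 0" for s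
  proof -
    have "(\<lambda>x. V x * (\<omega> x s * (p x s)\<^sup>2 / 2)) integrable_on {0..R}"
      using that by (intro V_times_integrable continuous_intros p_cont' \<omega>_cont') auto
    moreover have "(\<lambda>x. \<omega> x s * (q x s)\<^sup>2 / 2) integrable_on {0..R}"
      using that by (intro integrable_continuous_real continuous_intros q_cont' \<omega>_cont') auto
    ultimately have "(\<lambda>x. V x * (\<omega> x s * (p x s)\<^sup>2 / 2) + \<omega> x s * (q x s)\<^sup>2 / 2) integrable_on {0..R}"
      by (rule integrable_add)
    then show ?thesis by (simp add: field_simps)
  qed
  have bound: "\<omega> x t2 * ?e x t2 - \<omega> x t1 * ?e x t1 \<le> integral {t1..t2} (Q'i x)"
    if x: "x \<in> {0..R}" for x
  proof (rule has_integral_le)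
    show "((\<lambda>t. \<omega>t x t * ?e x t + \<omega> x t * (px x t * q x t + p x t * (V x * pt x t)))
        has_integral (\<omega> x t2 * ?e x t2 - \<omega> x t1 * ?e x t1)) {t1..t2}"
    proof (rule fundamental_theorem_of_calculus[OF t(2)])
      fix s assume s: "s \<in> {t1..t2}"
      have "{t1..t2} \<subseteq> {0..}" using t by auto
      then have "(p x has_real_derivative pt x s) (at s within {t1..t2})"
        "(q x has_real_derivative px x s) (at s within {t1..t2})"
        using x s t by (intro has_field_derivative_subset[OF p_t] has_field_derivative_subset[OF q_t]; auto)+
      moreover have "(\<omega> x has_real_derivative \<omega>t x s) (at s within {t1..t2})"
        by (rule has_field_derivative_at_within[OF \<omega>_deriv_t])
      ultimately show "((\<lambda>t. \<omega> x t * ?e x t) has_vector_derivative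
          \<omega>t x s * ?e x s + \<omega> x s * (px x s * q x s + p x s * (V x * pt x s))) (at s within {t1..t2})"
        unfolding has_real_derivative_iff_has_vector_derivative[symmetric]
        by (auto intro!: derivative_eq_intros simp: field_simps power2_eq_square)
    qed
    have "continuous_on {t1..t2} (Q'i x)"
      unfolding Q'i_def using x t
      by (intro continuous_intros p_cont' q_cont' pt_cont px_cont \<omega>_cont' \<omega>x_cont') auto
    then show "(Q'i x has_integral integral {t1..t2} (Q'i x)) {t1..t2}"
      by (intro integrable_integral integrable_continuous_real)
    show "\<omega>t x s * ?e x s + \<omega> x s * (px x s * q x s + p x s * (V x * pt x s)) \<le> Q'i x s"
      if "s \<in> {t1..t2}" for s
      unfolding Q'i_def using density_dominates_flux[of x "\<omega>x x s" "\<omega>t x s"] slope[OF x that] x by simp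
  qed
  have "integral {0..R} (\<lambda>x. \<omega> x t2 * ?e x t2) - integral {0..R} (\<lambda>x. \<omega> x t1 * ?e x t1) =
      integral {0..R} (\<lambda>x. \<omega> x t2 * ?e x t2 - \<omega> x t1 * ?e x t1)"
    using e_int t by (intro integral_diff[symmetric]) auto
  also have "\<dots> \<le> integral {0..R} (\<lambda>x. integral {t1..t2} (Q'i x))"
    using e_int t Q'_integral bound by (intro integral_le integrable_diff) auto
  also have "\<dots> = Q R - Q 0" using Q'_integral by (rule integral_unique)
  finally show ?thesis by (simp add: Q_def)
qed

text \<open>
  The limit \<open>h \<rightarrow> 0\<close> of \<open>averaged_energy_inequality\<close>; no derivative of \<open>p\<close> or \<open>q\<close> is left in it, so dominated
  convergence suffices.
\<close>
lemma weighted_energy_inequality: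
  assumes t: "0 \<le> t1" "t1 \<le> t2" and R: "0 \<le> R"
    and slope: "\<And>x t. x \<in> {0..R} \<Longrightarrow> t \<in> {t1..t2} \<Longrightarrow> 1 / sqrt m * \<bar>\<omega>x x t\<bar> \<le> - \<omega>t x t"
  shows "integral {0..R} (\<lambda>x. \<omega> x t2 * ((V x * (ut x t2)\<^sup>2 + (ux x t2)\<^sup>2) / 2)) -
      integral {0..R} (\<lambda>x. \<omega> x t1 * ((V x * (ut x t1)\<^sup>2 + (ux x t1)\<^sup>2) / 2)) \<le>
    integral {t1..t2} (\<lambda>t. \<omega> R t * (ut R t * ux R t)) -
      integral {t1..t2} (\<lambda>t. \<omega> 0 t * (ut 0 t * ux 0 t))"
proof -
  define h where "h n = inverse (real (Suc n))" for n
  have h: "h n > 0" "h n \<le> 1" for n by (auto simp: h_def field_simps)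
  let ?p = "\<lambda>n x. forward_mean (h n) (ut x)" and ?q = "\<lambda>n x. forward_mean (h n) (ux x)"
  have lim: "(\<lambda>n. ?p n x s) \<longlonglongrightarrow> ut x s" "(\<lambda>n. ?q n x s) \<longlonglongrightarrow> ux x s" if "x \<ge> 0" "s \<ge> 0" for x s
    unfolding h_def using that by (intro forward_mean_tendsto ut_cont_t ux_cont_t; simp)+
  have box: "compact ({0..R} \<times> {t1..t2 + 1})" by (intro compact_Times) auto
  have box_sub: "{0..R} \<times> {t1..t2 + 1} \<subseteq> {0..} \<times> {0..}" using t by auto
  have "\<exists>B. \<forall>x\<in>{0..R}. \<forall>s\<in>{t1..t2 + 1}. \<bar>g x s\<bar> \<le> B"
    if g: "continuous_on ({0..R} \<times> {t1..t2 + 1}) (\<lambda>(x, t). g x t)" for g :: "real \<Rightarrow> real \<Rightarrow> real"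
  proof -
    obtain B where "\<And>v. v \<in> {0..R} \<times> {t1..t2 + 1} \<Longrightarrow> \<bar>case v of (x, t) \<Rightarrow> g x t\<bar> \<le> B"
      using compact_imp_bounded[OF compact_continuous_image[OF g box]]
      unfolding bounded_iff by (metis imageI real_norm_def)
    then show ?thesis by fastforce
  qed
  note bnd = this
  obtain B1 where B1: "\<forall>x\<in>{0..R}. \<forall>s\<in>{t1..t2 + 1}. \<bar>ut x s\<bar> \<le> B1"
    using bnd[OF continuous_on_subset[OF ut_cont box_sub]] by blast
  obtain B2 where B2: "\<forall>x\<in>{0..R}. \<forall>s\<in>{t1..t2 + 1}. \<bar>ux x s\<bar> \<le> B2"
    using bnd[OF continuous_on_subset[OF ux_cont box_sub]] by blast
  obtain K where K: "\<forall>x\<in>{0..R}. \<forall>s\<in>{t1..t2 + 1}. \<bar>\<omega> x s\<bar> \<le> K"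
    using bnd[OF continuous_on_subset[OF \<omega>_cont]] by blast
  have pB: "\<bar>?p n x s\<bar> \<le> B1" and qB: "\<bar>?q n x s\<bar> \<le> B2" if "x \<in> {0..R}" "s \<in> {t1..t2}" for n x s
    using that h[of n] t B1 B2
    by (intro forward_mean_bound continuous_on_subset[OF ut_cont_t] continuous_on_subset[OF ux_cont_t]; auto)+
  have KK: "\<bar>\<omega> x s\<bar> \<le> K" if "x \<in> {0..R}" "s \<in> {t1..t2}" for x s using K that by auto
  have p_cont: "continuous_on ({0..} \<times> {0..}) (\<lambda>(x, t). ?p n x t)"
    and q_cont: "continuous_on ({0..} \<times> {0..}) (\<lambda>(x, t). ?q n x t)" for n
    using h by (intro forward_mean_cont ut_cont ux_cont; simp)+
  note p_cont' = continuous_on_uncurried[OF p_cont] and q_cont' = continuous_on_uncurried[OF q_cont]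
  let ?E = "\<lambda>p q s. integral {0..R} (\<lambda>x. \<omega> x s * ((V x * (p x s)\<^sup>2 + (q x s)\<^sup>2) / 2))"
  let ?B = "\<lambda>p q x. integral {t1..t2} (\<lambda>t. \<omega> x t * (p x t * q x t))"
  have E_lim: "(\<lambda>n. ?E (?p n) (?q n) s) \<longlonglongrightarrow> ?E ut ux s" if s: "s \<in> {t1..t2}" for s
  proof (rule dominated_convergence(2))
    show "(\<lambda>x. \<omega> x s * ((V x * (?p n x s)\<^sup>2 + (?q n x s)\<^sup>2) / 2)) integrable_on {0..R}" for n
    proof -
      have "(\<lambda>x. V x * (\<omega> x s * (?p n x s)\<^sup>2 / 2)) integrable_on {0..R}"
        using s t by (intro V_times_integrable continuous_intros p_cont' \<omega>_cont') auto
      moreover have "(\<lambda>x. \<omega> x s * (?q n x s)\<^sup>2 / 2) integrable_on {0..R}"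
        using s t by (intro integrable_continuous_real continuous_intros q_cont' \<omega>_cont') auto
      ultimately have "(\<lambda>x. V x * (\<omega> x s * (?p n x s)\<^sup>2 / 2) + \<omega> x s * (?q n x s)\<^sup>2 / 2) integrable_on {0..R}"
        by (rule integrable_add)
      then show ?thesis by (simp add: field_simps)
    qed
    show "(\<lambda>x. V x * (K * B1\<^sup>2 / 2) + K * B2\<^sup>2 / 2) integrable_on {0..R}"
      by (intro integrable_add V_times_integrable continuous_intros integrable_const_ivl) auto
    fix n x assume x: "x \<in> {0..R}"
    have "(?p n x s)\<^sup>2 \<le> B1\<^sup>2" "(?q n x s)\<^sup>2 \<le> B2\<^sup>2"
      using power_mono[OF pB[OF x s, of n], of 2] power_mono[OF qB[OF x s, of n], of 2] by simp_all
    moreover have Vx: "V x > 0" using x V_pos by simp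
    ultimately have "V x * (?p n x s)\<^sup>2 + (?q n x s)\<^sup>2 \<le> V x * B1\<^sup>2 + B2\<^sup>2"
      by (intro add_mono mult_left_mono) auto
    moreover have "0 \<le> V x * (?p n x s)\<^sup>2 + (?q n x s)\<^sup>2" using Vx by simp
    ultimately have majorant: "\<bar>\<omega> x s\<bar> * ((V x * (?p n x s)\<^sup>2 + (?q n x s)\<^sup>2) / 2) \<le> K * ((V x * B1\<^sup>2 + B2\<^sup>2) / 2)"
      using KK[OF x s] by (intro mult_mono) auto
    then show "norm (\<omega> x s * ((V x * (?p n x s)\<^sup>2 + (?q n x s)\<^sup>2) / 2)) \<le> V x * (K * B1\<^sup>2 / 2) + K * B2\<^sup>2 / 2"
    proof -
      have "V x * (K * B1\<^sup>2 / 2) + K * B2\<^sup>2 / 2 = K * ((V x * B1\<^sup>2 + B2\<^sup>2) / 2)"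
        by (simp add: field_simps)
      moreover have "norm (\<omega> x s * ((V x * (?p n x s)\<^sup>2 + (?q n x s)\<^sup>2) / 2)) =
          \<bar>\<omega> x s\<bar> * ((V x * (?p n x s)\<^sup>2 + (?q n x s)\<^sup>2) / 2)"
        using \<open>0 \<le> V x * (?p n x s)\<^sup>2 + (?q n x s)\<^sup>2\<close> by (simp add: abs_mult)
      ultimately show ?thesis using majorant by (simp only:)
    qed
  next
    fix x assume "x \<in> {0..R}"
    then show "(\<lambda>n. \<omega> x s * ((V x * (?p n x s)\<^sup>2 + (?q n x s)\<^sup>2) / 2)) \<longlonglongrightarrow>
        \<omega> x s * ((V x * (ut x s)\<^sup>2 + (ux x s)\<^sup>2) / 2)"
      using s t by (intro tendsto_intros lim) auto
  qed
  have B_lim: "(\<lambda>n. ?B (?p n) (?q n) x) \<longlonglongrightarrow> ?B ut ux x" if x: "x \<in> {0..R}" for x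
  proof (rule dominated_convergence(2))
    show "(\<lambda>t. \<omega> x t * (?p n x t * ?q n x t)) integrable_on {t1..t2}" for n
      using x t by (intro integrable_continuous_real continuous_intros q_cont' p_cont' \<omega>_cont') auto
    show "(\<lambda>t. K * (B1 * B2)) integrable_on {t1..t2}" by (rule integrable_const_ivl)
    fix n s assume s: "s \<in> {t1..t2}"
    have "\<bar>\<omega> x s\<bar> * (\<bar>?p n x s\<bar> * \<bar>?q n x s\<bar>) \<le> K * (B1 * B2)"
      using KK[OF x s] pB[OF x s, of n] qB[OF x s, of n] by (intro mult_mono) auto
    then show "norm (\<omega> x s * (?p n x s * ?q n x s)) \<le> K * (B1 * B2)" by (simp add: abs_mult)
  next
    fix s assume "s \<in> {t1..t2}"
    then show "(\<lambda>n. \<omega> x s * (?p n x s * ?q n x s)) \<longlonglongrightarrow> \<omega> x s * (ut x s * ux x s)"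
      using x t by (intro tendsto_intros lim) auto
  qed
  have "?E (?p n) (?q n) t2 - ?E (?p n) (?q n) t1 \<le> ?B (?p n) (?q n) R - ?B (?p n) (?q n) 0" for n
    using averaged_energy_inequality[OF h(1) t R slope] .
  then show ?thesis
    using t R by (intro LIMSEQ_le[of "\<lambda>n. ?E (?p n) (?q n) t2 - ?E (?p n) (?q n) t1" _
          "\<lambda>n. ?B (?p n) (?q n) R - ?B (?p n) (?q n) 0"] tendsto_diff E_lim B_lim) auto
qed

end

section \<open>Conservation of energy in cones\<close>
lemma positive_part_square_deriv:
  "((\<lambda>y::real. (max 0 y)\<^sup>2) has_real_derivative 2 * max 0 y) (at y)"
proof -
  consider "y < 0" | "y > 0" | "y = 0" by linarith
  then show ?thesis
  proof cases
    case 1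
    have "((\<lambda>y::real. 0) has_real_derivative 2 * max 0 y) (at y)" using 1 by simp
    then show ?thesis
      by (rule has_field_derivative_transform_within_open[where S = "{..<0}"]) (use 1 in auto)
  next
    case 2
    have "((\<lambda>y::real. y\<^sup>2) has_real_derivative 2 * max 0 y) (at y)"
      using 2 by (auto intro!: derivative_eq_intros)
    then show ?thesis
      by (rule has_field_derivative_transform_within_open[where S = "{0<..}"]) (use 2 in auto)
  next
    case 3
    have "((\<lambda>h::real. (max 0 h)\<^sup>2 / h) \<longlongrightarrow> 0) (at 0)"
    proof (rule Lim_null_comparison)
      show "\<forall>\<^sub>F h::real in at 0. norm ((max 0 h)\<^sup>2 / h) \<le> \<bar>h\<bar>"
        by (intro always_eventually) (auto simp: max_def power2_eq_square)
      show "((\<lambda>h::real. \<bar>h\<bar>) \<longlongrightarrow> 0) (at 0)"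
        by (auto intro!: tendsto_eq_intros)
    qed
    then show ?thesis using 3 by (simp add: has_field_derivative_iff)
  qed
qed

text \<open>
  The square of this function is a \<open>C\<^sup>1\<close> weight supported in a cone with axis \<open>x = x0\<close>. The root is a smooth
  substitute for \<open>\<bar>x - x0\<bar>\<close> with slope at most \<open>1\<close>. The cone shrinks in time for \<open>\<beta> > 0\<close> and grows for \<open>\<beta> < 0\<close>.
\<close>
definition cone_height :: "real \<Rightarrow> real \<Rightarrow> real \<Rightarrow> real \<Rightarrow> real \<Rightarrow> real" where
  "cone_height x0 \<rho> \<beta> x t = max 0 (\<rho> - \<beta> * t - sqrt (1 + (x - x0)\<^sup>2))"

lemma le_sqrt_one_plus_square: "\<bar>x\<bar> \<le> sqrt (1 + x\<^sup>2)"
  by (rule real_le_rsqrt) simp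

lemma one_plus_square_pos: "1 + (x::real)\<^sup>2 > 0"
  by (rule add_pos_nonneg) auto

context wave_field begin

definition energy_density :: "real \<Rightarrow> real \<Rightarrow> real" where
  "energy_density x t = (V x * (ut x t)\<^sup>2 + (ux x t)\<^sup>2) / 2"

lemma energy_density_nonneg: "x \<ge> 0 \<Longrightarrow> energy_density x t \<ge> 0"
  using V_pos[of x] by (simp add: energy_density_def)

lemma energy_density_integrable:
  assumes "0 \<le> a" "t \<ge> 0" and w: "continuous_on {a..b} w"
  shows "(\<lambda>x. w x * energy_density x t) integrable_on {a..b}"
proof -
  have "(\<lambda>x. V x * (w x * (ut x t)\<^sup>2 / 2)) integrable_on {a..b}"
    using assms by (intro V_times_integrable continuous_intros ut_cont' w) auto
  moreover have "(\<lambda>x. w x * (ux x t)\<^sup>2 / 2) integrable_on {a..b}"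
    using assms by (intro integrable_continuous_real continuous_intros ux_cont' w) auto
  ultimately have "(\<lambda>x. V x * (w x * (ut x t)\<^sup>2 / 2) + w x * (ux x t)\<^sup>2 / 2) integrable_on {a..b}"
    by (rule integrable_add)
  then show ?thesis by (simp add: field_simps energy_density_def)
qed

lemma energy_density_integrable1: "0 \<le> a \<Longrightarrow> t \<ge> 0 \<Longrightarrow> (\<lambda>x. energy_density x t) integrable_on {a..b}"
  using energy_density_integrable[of a t b "\<lambda>x. 1"] by simp

text \<open>
  For \<open>\<alpha> \<noteq> 0\<close> the condition on \<open>\<alpha>\<close> and \<open>\<beta>\<close> says that both have the same sign and that \<open>\<bar>\<beta>\<bar> = 1 / sqrt m\<close>. For \<open>\<alpha> > 0\<close> the
  weighted energy in a shrinking cone cannot increase; for \<open>\<alpha> < 0\<close> the inequality says that the weighted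
  energy in a growing cone cannot decrease, except for the work done at \<open>x = 0\<close> in both cases.
\<close>
lemma cone_energy_inequality:
  assumes slope: "\<alpha> * \<beta> = \<bar>\<alpha>\<bar> / sqrt m"
    and t: "0 \<le> t1" "t1 \<le> t2" and R: "0 \<le> R"
    and vanish: "\<And>t. t \<in> {t1..t2} \<Longrightarrow> cone_height x0 \<rho> \<beta> R t = 0"
  shows "integral {0..R} (\<lambda>x. \<alpha> * (cone_height x0 \<rho> \<beta> x t2)\<^sup>2 * energy_density x t2) -
      integral {0..R} (\<lambda>x. \<alpha> * (cone_height x0 \<rho> \<beta> x t1)\<^sup>2 * energy_density x t1) \<le>
    - integral {t1..t2} (\<lambda>t. \<alpha> * (cone_height x0 \<rho> \<beta> 0 t)\<^sup>2 * (ut 0 t * ux 0 t))"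
proof -
  let ?P = "cone_height x0 \<rho> \<beta>"
  let ?r = "\<lambda>x. sqrt (1 + (x - x0)\<^sup>2)"
  have r_pos: "?r x > 0" for x using one_plus_square_pos[of "x - x0"] by simp
  have P_cont: "continuous_on UNIV (\<lambda>v. ?P (fst v) (snd v))"
    unfolding cone_height_def by (intro continuous_intros)
  interpret weighted_wave_field V c c' D u ut ux m C "\<lambda>x t. \<alpha> * (?P x t)\<^sup>2"
    "\<lambda>x t. \<alpha> * (2 * ?P x t * - ((x - x0) / ?r x))" "\<lambda>x t. \<alpha> * (2 * ?P x t * - \<beta>)"
  proof unfold_locales
    fix x t
    have "((\<lambda>x. \<rho> - \<beta> * t - ?r x) has_real_derivative - ((x - x0) / ?r x)) (at x)"
      using one_plus_square_pos[of "x - x0"]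
      by (auto intro!: derivative_eq_intros simp: divide_simps)
    from DERIV_cmult[OF DERIV_chain2[OF positive_part_square_deriv this]]
    show "((\<lambda>x. \<alpha> * (?P x t)\<^sup>2) has_real_derivative \<alpha> * (2 * ?P x t * - ((x - x0) / ?r x))) (at x)"
      by (simp add: cone_height_def)
    have "((\<lambda>t. \<rho> - \<beta> * t - ?r x) has_real_derivative - \<beta>) (at t)"
      by (auto intro!: derivative_eq_intros)
    from DERIV_cmult[OF DERIV_chain2[OF positive_part_square_deriv this]]
    show "((\<lambda>t. \<alpha> * (?P x t)\<^sup>2) has_real_derivative \<alpha> * (2 * ?P x t * - \<beta>)) (at t)"
      by (simp add: cone_height_def)
  qed (unfold split_def, use r_pos in \<open>(intro continuous_intros P_cont; simp add: less_imp_neq[symmetric])+\<close>)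
  have "1 / sqrt m * \<bar>\<alpha> * (2 * ?P x t * - ((x - x0) / ?r x))\<bar> \<le> - (\<alpha> * (2 * ?P x t * - \<beta>))" for x t
  proof -
    have P0: "?P x t \<ge> 0" by (simp add: cone_height_def)
    have "\<bar>(x - x0) / ?r x\<bar> \<le> 1"
      using le_sqrt_one_plus_square[of "x - x0"] r_pos[of x] by (simp add: abs_divide)
    then have "(\<bar>\<alpha>\<bar> / sqrt m) * (2 * ?P x t) * \<bar>(x - x0) / ?r x\<bar> \<le> (\<bar>\<alpha>\<bar> / sqrt m) * (2 * ?P x t) * 1"
      using P0 m_pos by (intro mult_left_mono) auto
    moreover have "1 / sqrt m * \<bar>\<alpha> * (2 * ?P x t * - ((x - x0) / ?r x))\<bar> =
        (\<bar>\<alpha>\<bar> / sqrt m) * (2 * ?P x t) * \<bar>(x - x0) / ?r x\<bar>"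
      using P0 by (simp only: abs_mult abs_minus_cancel abs_numeral) simp
    moreover have "- (\<alpha> * (2 * ?P x t * - \<beta>)) = (\<alpha> * \<beta>) * (2 * ?P x t)" by simp
    ultimately show ?thesis by (simp only: slope mult_1_right)
  qed
  from weighted_energy_inequality[OF t R this]
  have "integral {0..R} (\<lambda>x. \<alpha> * (?P x t2)\<^sup>2 * energy_density x t2) -
      integral {0..R} (\<lambda>x. \<alpha> * (?P x t1)\<^sup>2 * energy_density x t1) \<le>
    integral {t1..t2} (\<lambda>t. \<alpha> * (?P R t)\<^sup>2 * (ut R t * ux R t)) -
      integral {t1..t2} (\<lambda>t. \<alpha> * (?P 0 t)\<^sup>2 * (ut 0 t * ux 0 t))"
    unfolding energy_density_def .
  moreover have "integral {t1..t2} (\<lambda>t. \<alpha> * (?P R t)\<^sup>2 * (ut R t * ux R t)) = 0"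
    using integral_cong[of "{t1..t2}" "\<lambda>t. \<alpha> * (?P R t)\<^sup>2 * (ut R t * ux R t)" "\<lambda>t. 0"] vanish by simp
  ultimately show ?thesis by simp
qed

end

text \<open>
  \<open>F(b) - F(a) - a (f(b) - f(a)) = \<integral> (f(b) - f(\<sigma>)) d\<sigma>\<close> over \<open>[a, b]\<close>, and the integrand lies between \<open>0\<close> and
  \<open>f(b) - f(a)\<close>.
\<close>
lemma boundary_energy_increment:
  assumes f: "mono f" "continuous_on UNIV f"
  shows "\<bar>boundary_energy f b - boundary_energy f a - a * (f b - f a)\<bar> \<le> \<bar>b - a\<bar> * \<bar>f b - f a\<bar>"
proof -
  define G where "G s = (LBINT \<sigma>=0..ereal s. f \<sigma>)" for s
  have G: "(G has_real_derivative f s) (at s)" for s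
  proof -
    define A where "A = min 0 s - 1"
    define B where "B = max 0 s + 1"
    have "((\<lambda>v. LBINT \<sigma>=ereal 0..ereal v. f \<sigma>) has_vector_derivative f s) (at s within {A..B})"
      by (rule interval_integral_FTC2[OF _ _ continuous_on_subset[OF f(2)]]) (auto simp: A_def B_def)
    moreover have "at s within {A..B} = at s"
      by (rule at_within_interior) (auto simp: A_def B_def)
    ultimately show ?thesis
      by (simp add: has_real_derivative_iff_has_vector_derivative G_def[abs_def] zero_ereal_def)
  qed
  have mvt: "\<exists>\<xi>. G b - G a = (b - a) * f \<xi> \<and> min a b \<le> \<xi> \<and> \<xi> \<le> max a b" for a b
  proof -
    consider "a < b" | "b < a" | "a = b" by linarith
    then show ?thesis
    proof cases
      case 1
      from MVT2[OF this, of G f] G obtain \<xi> where "a < \<xi>" "\<xi> < b" "G b - G a = (b - a) * f \<xi>" by blast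
      then show ?thesis by (intro exI[of _ \<xi>]) auto
    next
      case 2
      from MVT2[OF this, of G f] G obtain \<xi> where "b < \<xi>" "\<xi> < a" "G a - G b = (a - b) * f \<xi>" by blast
      then show ?thesis by (intro exI[of _ \<xi>]) (auto simp: algebra_simps)
    qed auto
  qed
  obtain \<xi> where \<xi>: "G b - G a = (b - a) * f \<xi>" "min a b \<le> \<xi>" "\<xi> \<le> max a b" using mvt by blast
  have "f (min a b) \<le> f \<xi>" "f \<xi> \<le> f (max a b)" using \<xi> f(1) by (auto dest: monoD)
  then have "\<bar>f b - f \<xi>\<bar> \<le> \<bar>f b - f a\<bar>"
    by (cases "a \<le> b") (auto simp: min_def max_def)
  moreover have "boundary_energy f b - boundary_energy f a - a * (f b - f a) = (b - a) * (f b - f \<xi>)"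
    using \<xi>(1) by (simp add: boundary_energy_def G_def algebra_simps)
  ultimately show ?thesis by (simp add: abs_mult mult_left_mono)
qed

text \<open>
  Differentiability of \<open>f \<circ> y\<close> suffices, because the error in \<open>boundary_energy_increment\<close> is the product of the
  increments of \<open>y\<close> and \<open>f \<circ> y\<close>, which is \<open>o(s - t)\<close> as soon as \<open>y\<close> is continuous.
\<close>
lemma boundary_energy_deriv:
  assumes f: "mono f" "continuous_on UNIV f"
    and y: "continuous (at t within S) y"
    and z: "((\<lambda>s. f (y s)) has_real_derivative z') (at t within S)"
  shows "((\<lambda>s. boundary_energy f (y s)) has_real_derivative y t * z') (at t within S)"
proof -
  let ?B = "\<lambda>s. boundary_energy f (y s)"
  let ?q = "\<lambda>s. (f (y s) - f (y t)) / (s - t)"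
  have q: "(?q \<longlongrightarrow> z') (at t within S)" using z by (simp add: has_field_derivative_iff)
  have y0: "((\<lambda>s. \<bar>y s - y t\<bar>) \<longlongrightarrow> 0) (at t within S)"
    using y unfolding continuous_within by (auto intro!: tendsto_eq_intros)
  have "((\<lambda>s. (?B s - ?B t) / (s - t) - y t * ?q s) \<longlongrightarrow> 0) (at t within S)"
  proof (rule Lim_null_comparison)
    show "((\<lambda>s. \<bar>y s - y t\<bar> * \<bar>?q s\<bar>) \<longlongrightarrow> 0) (at t within S)"
      using tendsto_mult[OF y0 tendsto_rabs[OF q]] by simp
    have "norm ((?B s - ?B t) / (s - t) - y t * ?q s) \<le> \<bar>y s - y t\<bar> * \<bar>?q s\<bar>" for s
    proof -
      have "(?B s - ?B t) / (s - t) - y t * ?q s = (?B s - ?B t - y t * (f (y s) - f (y t))) / (s - t)"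
        by (simp add: diff_divide_distrib right_diff_distrib)
      then have "norm ((?B s - ?B t) / (s - t) - y t * ?q s) =
          \<bar>?B s - ?B t - y t * (f (y s) - f (y t))\<bar> / \<bar>s - t\<bar>"
        by (simp only: real_norm_def abs_divide)
      also have "\<dots> \<le> (\<bar>y s - y t\<bar> * \<bar>f (y s) - f (y t)\<bar>) / \<bar>s - t\<bar>"
        by (intro divide_right_mono boundary_energy_increment f) auto
      finally show ?thesis by (simp add: abs_divide)
    qed
    then show "\<forall>\<^sub>F s in at t within S. norm ((?B s - ?B t) / (s - t) - y t * ?q s) \<le> \<bar>y s - y t\<bar> * \<bar>?q s\<bar>"
      by (intro always_eventually) auto
  qed
  from tendsto_add[OF this tendsto_mult_left[OF q, of "y t"]]
  show ?thesis by (simp add: has_field_derivative_iff)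
qed

text \<open>
  Cone weights of height \<open>N\<close>, divided by \<open>N\<^sup>2\<close>, tend to \<open>1\<close> at every point as \<open>N \<rightarrow> \<infinity>\<close>.
\<close>
lemma normalised_height_tendsto:
  "(\<lambda>n. (max 0 (real (Suc n) - b))\<^sup>2 / (real (Suc n))\<^sup>2) \<longlonglongrightarrow> 1"
proof -
  have "(\<lambda>n. (max 0 (1 - b * inverse (real (Suc n))))\<^sup>2) \<longlonglongrightarrow> (max 0 (1 - b * 0))\<^sup>2"
    by (intro tendsto_intros LIMSEQ_inverse_real_of_nat)
  moreover have "(max 0 (1 - b * inverse (real (Suc n))))\<^sup>2 = (max 0 (real (Suc n) - b))\<^sup>2 / (real (Suc n))\<^sup>2" for n
  proof -
    have "max 0 (N - b) / N = max 0 (1 - b * inverse N)" if "N > 0" for N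
      using that by (cases "b \<le> N") (auto simp: max_def field_simps)
    from this[of "real (Suc n)"] show ?thesis by (simp only: power_divide[symmetric])
  qed
  ultimately show ?thesis by simp
qed

lemma normalised_height_le:
  fixes N b :: real
  assumes "N \<ge> 1"
  shows "(max 0 (N - b))\<^sup>2 / N\<^sup>2 \<le> (1 + max 0 (- b))\<^sup>2"
proof -
  have "max 0 (- b) \<le> max 0 (- b) * N"
    using mult_left_mono[OF assms, of "max 0 (- b)"] by simp
  then have "N - b \<le> (1 + max 0 (- b)) * N" by (simp add: algebra_simps max_def split: if_splits)
  moreover have "0 \<le> (1 + max 0 (- b)) * N" using assms by simp
  ultimately have "max 0 (N - b) / N \<le> 1 + max 0 (- b)"
    using assms by (simp add: pos_divide_le_eq)
  then have "(max 0 (N - b) / N)\<^sup>2 \<le> (1 + max 0 (- b))\<^sup>2"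
    using assms by (intro power_mono) auto
  then show ?thesis by (simp add: power_divide)
qed

locale boundary_wave_field = wave_field +
  fixes f :: "real \<Rightarrow> real"
  assumes f_mono: "mono f" and f_cont: "continuous_on UNIV f"
    and boundary: "\<And>t. t \<ge> 0 \<Longrightarrow> ((\<lambda>s. f (ut 0 s)) has_real_derivative ux 0 t) (at t within {0..})"
begin

lemma boundary_work:
  assumes "0 \<le> t1" "t1 \<le> t2"
  shows "((\<lambda>t. ut 0 t * ux 0 t) has_integral
    boundary_energy f (ut 0 t2) - boundary_energy f (ut 0 t1)) {t1..t2}"
proof (rule fundamental_theorem_of_calculus[OF assms(2)])
  fix t assume t: "t \<in> {t1..t2}"
  have "((\<lambda>s. boundary_energy f (ut 0 s)) has_real_derivative ut 0 t * ux 0 t) (at t within {0..})"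
    using t assms ut_cont_t[of 0]
    by (intro boundary_energy_deriv f_mono f_cont boundary)
      (auto simp: continuous_on_eq_continuous_within)
  then show "((\<lambda>s. boundary_energy f (ut 0 s)) has_vector_derivative ut 0 t * ux 0 t) (at t within {t1..t2})"
    unfolding has_real_derivative_iff_has_vector_derivative[symmetric]
    by (rule has_field_derivative_subset) (use assms in auto)
qed

text \<open>
  The cones, of height less than \<open>N\<close> at time \<open>s\<close>, shrink from \<open>s\<close> towards \<open>t\<close>, in whichever direction that is. The
  sign \<open>\<sigma>\<close> of \<open>t - s\<close> is a factor of the weight as well as of the slope of the cone. At time \<open>s\<close> the
  normalised weight is at most \<open>1\<close>, which brings in the bound \<open>K\<close>; at time \<open>t\<close> and at \<open>x = 0\<close> it tends to \<open>1\<close>.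
\<close>
lemma energy_domination:
  assumes s: "s \<ge> 0" and t: "t \<ge> 0" and L: "L \<ge> 0"
    and K: "\<And>R. R \<ge> 0 \<Longrightarrow> integral {0..R} (\<lambda>x. energy_density x s) \<le> K"
  shows "integral {0..L} (\<lambda>x. energy_density x t) + boundary_energy f (ut 0 t) \<le>
    K + boundary_energy f (ut 0 s)"
proof -
  define \<sigma> :: real where "\<sigma> = (if s \<le> t then 1 else - 1)"
  define t1 where "t1 = min s t"
  define t2 where "t2 = max s t"
  define \<kappa> where "\<kappa> = 1 / sqrt m"
  have \<kappa>: "\<kappa> > 0" using m_pos by (simp add: \<kappa>_def)
  have tt: "0 \<le> t1" "t1 \<le> t2" using s t by (auto simp: t1_def t2_def)
  have \<sigma>: "\<bar>\<sigma>\<bar> = 1" "\<sigma> * \<sigma> = 1" by (auto simp: \<sigma>_def)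
  let ?N = "\<lambda>n. real (Suc n)"
  define b where "b x r = \<sigma> * \<kappa> * (r - s) + sqrt (1 + x\<^sup>2)" for x r
  define w where "w n x r = (max 0 (?N n - b x r))\<^sup>2 / (?N n)\<^sup>2" for n x r
  define T where "T = \<kappa> * (t1 + t2)"
  have b_lower: "\<bar>x\<bar> - T \<le> b x r" if r: "r \<in> {t1..t2}" for x r
  proof -
    have "\<bar>r - s\<bar> \<le> t1 + t2" using r s t by (auto simp: t1_def t2_def)
    then have "\<kappa> * \<bar>r - s\<bar> \<le> T" using \<kappa> by (simp add: T_def)
    moreover have "\<bar>\<sigma> * \<kappa> * (r - s)\<bar> = \<kappa> * \<bar>r - s\<bar>" using \<sigma> \<kappa> by (simp add: abs_mult)
    ultimately have "- T \<le> \<sigma> * \<kappa> * (r - s)" by linarith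
    then show ?thesis using le_sqrt_one_plus_square[of x] by (simp add: b_def)
  qed
  have T: "T \<ge> 0" using \<kappa> tt by (simp add: T_def)
  have w_nonneg: "w n x r \<ge> 0" for n x r by (simp add: w_def)
  have w_le: "w n x r \<le> (1 + T)\<^sup>2" if "r \<in> {t1..t2}" for n x r
  proof -
    have "w n x r \<le> (1 + max 0 (- b x r))\<^sup>2"
      unfolding w_def by (rule normalised_height_le) simp
    also have "\<dots> \<le> (1 + T)\<^sup>2"
      using b_lower[OF that, of x] T by (intro power_mono) auto
    finally show ?thesis .
  qed
  have w_le1: "w n x s \<le> 1" for n x
    unfolding w_def using normalised_height_le[of "?N n" "b x s"]
    by (simp add: b_def max_def)
  have w_lim: "(\<lambda>n. w n x r) \<longlonglongrightarrow> 1" for x r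
    unfolding w_def by (rule normalised_height_tendsto)
  have w_cont: "continuous_on S (\<lambda>x. w n (g x) (h x))"
    if "continuous_on S g" "continuous_on S h" for n g h and S :: "real set"
    unfolding w_def b_def by (intro continuous_intros that) auto
  have st: "s \<in> {t1..t2}" "t \<in> {t1..t2}" by (auto simp: t1_def t2_def)
  have key: "integral {0..L} (\<lambda>x. w n x t * energy_density x t) \<le>
      K - \<sigma> * integral {t1..t2} (\<lambda>r. w n 0 r * (ut 0 r * ux 0 r))" if n: "real n \<ge> L" for n
  proof -
    define R where "R = ?N n + T"
    have R: "0 \<le> R" "L \<le> R" using T n by (auto simp: R_def)
    let ?P = "cone_height 0 (?N n + \<sigma> * \<kappa> * s) (\<sigma> * \<kappa>)"
    have w_eq: "\<sigma> / (?N n)\<^sup>2 * (?P x r)\<^sup>2 = \<sigma> * w n x r" for x r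
    proof -
      have "?N n + \<sigma> * \<kappa> * s - \<sigma> * \<kappa> * r - sqrt (1 + (x - 0)\<^sup>2) = ?N n - b x r"
        by (simp add: b_def algebra_simps)
      then show ?thesis by (simp only: w_def cone_height_def times_divide_eq_left times_divide_eq_right)
    qed
    have "?P R r = 0" if "r \<in> {t1..t2}" for r
      using b_lower[OF that, of R] R(1) by (simp add: cone_height_def b_def R_def algebra_simps)
    then have "integral {0..R} (\<lambda>x. \<sigma> / (?N n)\<^sup>2 * (?P x t2)\<^sup>2 * energy_density x t2) -
        integral {0..R} (\<lambda>x. \<sigma> / (?N n)\<^sup>2 * (?P x t1)\<^sup>2 * energy_density x t1) \<le>
        - integral {t1..t2} (\<lambda>r. \<sigma> / (?N n)\<^sup>2 * (?P 0 r)\<^sup>2 * (ut 0 r * ux 0 r))"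
      using \<sigma> tt R
      by (intro cone_energy_inequality) (auto simp: \<kappa>_def abs_divide)
    then have "\<sigma> * integral {0..R} (\<lambda>x. w n x t2 * energy_density x t2) -
        \<sigma> * integral {0..R} (\<lambda>x. w n x t1 * energy_density x t1) \<le>
        - (\<sigma> * integral {t1..t2} (\<lambda>r. w n 0 r * (ut 0 r * ux 0 r)))"
      unfolding w_eq mult.assoc[of \<sigma> "w n x r" for x r] by (simp only: integral_mult_right)
    then have "integral {0..R} (\<lambda>x. w n x t * energy_density x t) \<le>
        integral {0..R} (\<lambda>x. w n x s * energy_density x s) -
        \<sigma> * integral {t1..t2} (\<lambda>r. w n 0 r * (ut 0 r * ux 0 r))"
      by (cases "s \<le> t") (auto simp: \<sigma>_def t1_def t2_def)
    moreover have "integral {0..R} (\<lambda>x. w n x s * energy_density x s) \<le> K"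
    proof -
      have "integral {0..R} (\<lambda>x. w n x s * energy_density x s) \<le> integral {0..R} (\<lambda>x. energy_density x s)"
        using s w_le1 energy_density_nonneg
        by (intro integral_le energy_density_integrable energy_density_integrable1 w_cont continuous_intros)
          (auto intro: mult_left_le_one_le w_nonneg)
      then show ?thesis using K[OF R(1)] by linarith
    qed
    moreover have "integral {0..L} (\<lambda>x. w n x t * energy_density x t) \<le>
        integral {0..R} (\<lambda>x. w n x t * energy_density x t)"
      using R t
      by (intro integral_subset_le energy_density_integrable w_cont continuous_intros)
        (auto simp: w_nonneg energy_density_nonneg)
    ultimately show ?thesis by linarith
  qed
  have lim1: "(\<lambda>n. integral {0..L} (\<lambda>x. w n x t * energy_density x t)) \<longlonglongrightarrow>
      integral {0..L} (\<lambda>x. energy_density x t)"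
  proof (rule dominated_convergence(2))
    show "(\<lambda>x. w n x t * energy_density x t) integrable_on {0..L}" for n
      using t by (intro energy_density_integrable w_cont continuous_intros) auto
    show "(\<lambda>x. (1 + T)\<^sup>2 * energy_density x t) integrable_on {0..L}"
      using t by (intro energy_density_integrable continuous_intros) auto
    fix n x assume "x \<in> {0..L}"
    then show "norm (w n x t * energy_density x t) \<le> (1 + T)\<^sup>2 * energy_density x t"
      using w_le[OF st(2), of n x] w_nonneg[of n x t] energy_density_nonneg[of x t]
      by (simp add: abs_mult mult_right_mono)
  next
    fix x show "(\<lambda>n. w n x t * energy_density x t) \<longlonglongrightarrow> energy_density x t"
      using tendsto_mult_right[OF w_lim] by simp
  qed
  have uu: "continuous_on {t1..t2} (\<lambda>r. ut 0 r * ux 0 r)"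
    using tt by (intro continuous_intros ut_cont' ux_cont') auto
  have lim2: "(\<lambda>n. integral {t1..t2} (\<lambda>r. w n 0 r * (ut 0 r * ux 0 r))) \<longlonglongrightarrow>
      integral {t1..t2} (\<lambda>r. ut 0 r * ux 0 r)"
  proof (rule dominated_convergence(2))
    show "(\<lambda>r. w n 0 r * (ut 0 r * ux 0 r)) integrable_on {t1..t2}" for n
      by (intro integrable_continuous_real continuous_on_mult[OF w_cont uu] continuous_intros)
    show "(\<lambda>r. (1 + T)\<^sup>2 * \<bar>ut 0 r * ux 0 r\<bar>) integrable_on {t1..t2}"
      by (intro integrable_continuous_real continuous_intros uu)
    fix n r assume "r \<in> {t1..t2}"
    then show "norm (w n 0 r * (ut 0 r * ux 0 r)) \<le> (1 + T)\<^sup>2 * \<bar>ut 0 r * ux 0 r\<bar>"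
      using w_le[of r n 0] w_nonneg[of n 0 r]
      unfolding real_norm_def abs_mult[of "w n 0 r"] by (intro mult_right_mono) auto
  next
    fix r show "(\<lambda>n. w n 0 r * (ut 0 r * ux 0 r)) \<longlonglongrightarrow> ut 0 r * ux 0 r"
      using tendsto_mult_right[OF w_lim] by simp
  qed
  have "\<forall>\<^sub>F n in sequentially. integral {0..L} (\<lambda>x. w n x t * energy_density x t) \<le>
      K - \<sigma> * integral {t1..t2} (\<lambda>r. w n 0 r * (ut 0 r * ux 0 r))"
    using eventually_ge_at_top[of "nat \<lceil>L\<rceil>"]
  proof eventually_elim
    case (elim n)
    then show ?case by (intro key) linarith
  qed
  from tendsto_le[OF sequentially_bot tendsto_diff[OF tendsto_const tendsto_mult_left[OF lim2]] lim1 this]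
  have "integral {0..L} (\<lambda>x. energy_density x t) \<le>
      K - \<sigma> * integral {t1..t2} (\<lambda>r. ut 0 r * ux 0 r)" .
  moreover have "\<sigma> * integral {t1..t2} (\<lambda>r. ut 0 r * ux 0 r) =
      boundary_energy f (ut 0 t) - boundary_energy f (ut 0 s)"
    using integral_unique[OF boundary_work[OF tt]]
    by (cases "s \<le> t") (auto simp: \<sigma>_def t1_def t2_def)
  ultimately show ?thesis by simp
qed

end

section \<open>Decay of the flux and conservation of momentum\<close>
context wave_field begin

lemma V_integral_le:
  assumes a: "0 \<le> a" and g: "continuous_on {a..b} g" "\<And>x. x \<in> {a..b} \<Longrightarrow> 0 \<le> g x"
  shows "integral {a..b} (\<lambda>x. V x * g x) \<le> C * integral {a..b} g"
proof -
  have g_int: "set_integrable lborel {a..b} (\<lambda>x. C * g x)"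
    using g(1) by (intro borel_integrable_atLeastAtMost' continuous_intros)
  have "integral {a..b} (\<lambda>x. V x * g x) = (LBINT x:{a..b}. V x * g x)"
    using V_times_integrable(1)[OF a g(1)] by (simp add: set_borel_integral_eq_integral)
  also have "\<dots> \<le> (LBINT x:{a..b}. C * g x)"
  proof (rule set_integral_mono_AE[OF V_times_integrable(1)[OF a g(1)] g_int])
    show "AE x \<in> {a..b} in lborel. V x * g x \<le> C * g x"
      using V_upper
    proof eventually_elim
      case (elim x)
      then show ?case using a g(2)[of x] by (auto intro!: mult_right_mono)
    qed
  qed
  also have "\<dots> = integral {a..b} (\<lambda>x. C * g x)"
    by (rule set_borel_integral_eq_integral(2)[OF g_int])
  finally show ?thesis by simp
qed

text \<open>
  The energy in \<open>[x, x + 1]\<close> at a time up to \<open>T\<close> comes from the energy at time \<open>0\<close> in an interval of fixed length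
  around \<open>x\<close>. The radius \<open>\<kappa> T + 2\<close> leaves the cone a height of at least \<open>1 / 2\<close> on \<open>[x, x + 1]\<close> until \<open>T\<close>.
\<close>
lemma local_energy_decay:
  assumes decay: "((\<lambda>x. ut x 0) \<longlongrightarrow> 0) at_top" "((\<lambda>x. ux x 0) \<longlongrightarrow> 0) at_top"
    and T: "T \<ge> 0" and \<delta>: "\<delta> > 0"
  obtains X where "X > 0"
    "\<And>x t. x \<ge> X \<Longrightarrow> 0 \<le> t \<Longrightarrow> t \<le> T \<Longrightarrow> integral {x..x + 1} (\<lambda>x. energy_density x t) \<le> \<delta>"
proof -
  define \<kappa> where "\<kappa> = 1 / sqrt m"
  have \<kappa>: "\<kappa> > 0" using m_pos by (simp add: \<kappa>_def)
  define \<rho> where "\<rho> = \<kappa> * T + 2"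
  have \<rho>: "\<rho> > 0" using \<kappa> T by (simp add: \<rho>_def add_nonneg_pos)
  define M where "M = \<rho>\<^sup>2 * (\<bar>C\<bar> + 1) * (2 * \<rho>)"
  have M: "M > 0" using \<rho> by (simp add: M_def)
  define \<epsilon> where "\<epsilon> = sqrt (\<delta> / (4 * M)) "
  have \<epsilon>: "\<epsilon> > 0" using M \<delta> by (simp add: \<epsilon>_def)
  have \<epsilon>2: "\<epsilon>\<^sup>2 = \<delta> / (4 * M)" using M \<delta> by (simp add: \<epsilon>_def)
  have "\<forall>\<^sub>F x in at_top. \<bar>ut x 0\<bar> < \<epsilon> \<and> \<bar>ux x 0\<bar> < \<epsilon>"
    using tendstoD[OF decay(1) \<epsilon>] tendstoD[OF decay(2) \<epsilon>] by eventually_elim auto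
  then obtain X0 where X0: "\<And>x. x \<ge> X0 \<Longrightarrow> \<bar>ut x 0\<bar> < \<epsilon> \<and> \<bar>ux x 0\<bar> < \<epsilon>"
    unfolding eventually_at_top_linorder by blast
  show ?thesis
  proof (rule that[of "\<bar>X0\<bar> + \<rho> + 1"])
    show "\<bar>X0\<bar> + \<rho> + 1 > 0" using \<rho> by simp
    fix x0 t assume x0: "x0 \<ge> \<bar>X0\<bar> + \<rho> + 1" and t: "0 \<le> t" "t \<le> T"
    let ?P = "cone_height x0 \<rho> \<kappa>"
    define R where "R = x0 + \<rho>"
    have x0_pos: "x0 > 0" and R: "0 \<le> R" using x0 \<rho> by (auto simp: R_def)
    have r: "\<bar>x - x0\<bar> \<le> sqrt (1 + (x - x0)\<^sup>2)" for x by (rule le_sqrt_one_plus_square)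
    have vanish: "?P x r = 0" if "\<bar>x - x0\<bar> \<ge> \<rho>" "0 \<le> r" for x r
    proof -
      have "\<kappa> * r \<ge> 0" using \<kappa> that by simp
      then show ?thesis using r[of x] that unfolding cone_height_def by linarith
    qed
    have P_cont: "continuous_on A (\<lambda>x. 1 * (?P x r)\<^sup>2)" for A r
      unfolding cone_height_def by (intro continuous_intros)
    have "integral {0..R} (\<lambda>x. 1 * (?P x t)\<^sup>2 * energy_density x t) -
        integral {0..R} (\<lambda>x. 1 * (?P x 0)\<^sup>2 * energy_density x 0) \<le>
        - integral {0..t} (\<lambda>t. 1 * (?P 0 t)\<^sup>2 * (ut 0 t * ux 0 t))"
      using t R x0 \<rho> vanish
      by (intro cone_energy_inequality) (auto simp: \<kappa>_def R_def)
    moreover have "integral {0..t} (\<lambda>t. 1 * (?P 0 t)\<^sup>2 * (ut 0 t * ux 0 t)) = 0"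
    proof -
      have "integral {0..t} (\<lambda>t. 1 * (?P 0 t)\<^sup>2 * (ut 0 t * ux 0 t)) = integral {0..t} (\<lambda>t. 0)"
        using vanish[of 0] x0 x0_pos by (intro integral_cong) auto
      then show ?thesis by simp
    qed
    ultimately have 1: "integral {0..R} (\<lambda>x. 1 * (?P x t)\<^sup>2 * energy_density x t) \<le>
        integral {0..R} (\<lambda>x. 1 * (?P x 0)\<^sup>2 * energy_density x 0)" by linarith
    have "integral {x0..x0 + 1} (\<lambda>x. 1 / 4 * energy_density x t) \<le>
        integral {x0..x0 + 1} (\<lambda>x. 1 * (?P x t)\<^sup>2 * energy_density x t)"
    proof (rule integral_le)
      show "(\<lambda>x. 1 / 4 * energy_density x t) integrable_on {x0..x0 + 1}"
        "(\<lambda>x. 1 * (?P x t)\<^sup>2 * energy_density x t) integrable_on {x0..x0 + 1}"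
        using x0_pos t by (intro energy_density_integrable P_cont continuous_intros; simp)+
      fix x assume x: "x \<in> {x0..x0 + 1}"
      have "(x - x0)\<^sup>2 \<le> 1\<^sup>2" using x by (intro power_mono) auto
      then have "sqrt (1 + (x - x0)\<^sup>2) \<le> 3 / 2"
        by (intro real_le_lsqrt) (auto simp: power2_eq_square)
      moreover have "\<kappa> * t \<le> \<kappa> * T" using \<kappa> t by simp
      ultimately have "1 / 2 \<le> ?P x t" unfolding cone_height_def \<rho>_def by linarith
      then have "(1 / 2)\<^sup>2 \<le> (?P x t)\<^sup>2" by (intro power_mono) auto
      then show "1 / 4 * energy_density x t \<le> 1 * (?P x t)\<^sup>2 * energy_density x t"
        using energy_density_nonneg[of x t] x x0_pos
        by (intro mult_right_mono) (auto simp: power_divide)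
    qed
    also have "\<dots> \<le> integral {0..R} (\<lambda>x. 1 * (?P x t)\<^sup>2 * energy_density x t)"
      using x0_pos t \<rho> \<kappa> T
      by (intro integral_subset_le energy_density_integrable P_cont)
        (auto simp: energy_density_nonneg R_def \<rho>_def add_nonneg_nonneg)
    also note 1
    also have "integral {0..R} (\<lambda>x. 1 * (?P x 0)\<^sup>2 * energy_density x 0) \<le> M * \<epsilon>\<^sup>2"
    proof -
      define a where "a = x0 - \<rho>"
      have a: "0 \<le> a" "a \<le> R" "R - a = 2 * \<rho>" using x0 \<rho> by (auto simp: a_def R_def)
      have "integral {0..R} (\<lambda>x. 1 * (?P x 0)\<^sup>2 * energy_density x 0) =
          integral {a..R} (\<lambda>x. 1 * (?P x 0)\<^sup>2 * energy_density x 0)"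
      proof -
        have "integral {0..a} (\<lambda>x. 1 * (?P x 0)\<^sup>2 * energy_density x 0) = integral {0..a} (\<lambda>x. 0)"
          using vanish by (intro integral_cong) (auto simp: a_def)
        moreover have "integral {0..a} (\<lambda>x. 1 * (?P x 0)\<^sup>2 * energy_density x 0) +
            integral {a..R} (\<lambda>x. 1 * (?P x 0)\<^sup>2 * energy_density x 0) =
            integral {0..R} (\<lambda>x. 1 * (?P x 0)\<^sup>2 * energy_density x 0)"
          using a by (intro Henstock_Kurzweil_Integration.integral_combine energy_density_integrable P_cont) auto
        ultimately show ?thesis by simp
      qed
      also have "\<dots> \<le> integral {a..R} (\<lambda>x. V x * (\<rho>\<^sup>2 * \<epsilon>\<^sup>2) + \<rho>\<^sup>2 * \<epsilon>\<^sup>2)"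
      proof (rule integral_le)
        show "(\<lambda>x. 1 * (?P x 0)\<^sup>2 * energy_density x 0) integrable_on {a..R}"
          using a by (intro energy_density_integrable P_cont) auto
        show "(\<lambda>x. V x * (\<rho>\<^sup>2 * \<epsilon>\<^sup>2) + \<rho>\<^sup>2 * \<epsilon>\<^sup>2) integrable_on {a..R}"
          using a by (intro integrable_add V_times_integrable continuous_intros integrable_const_ivl) auto
        fix x assume x: "x \<in> {a..R}"
        then have "x \<ge> X0" using x0 by (auto simp: a_def)
        from X0[OF this] have "(ut x 0)\<^sup>2 \<le> \<epsilon>\<^sup>2" "(ux x 0)\<^sup>2 \<le> \<epsilon>\<^sup>2"
          using power_mono[of "\<bar>ut x 0\<bar>" \<epsilon> 2] power_mono[of "\<bar>ux x 0\<bar>" \<epsilon> 2] by auto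
        moreover have Vx: "V x > 0" using V_pos x a by simp
        ultimately have "V x * (ut x 0)\<^sup>2 \<le> V x * \<epsilon>\<^sup>2" by (intro mult_left_mono) auto
        then have e: "energy_density x 0 \<le> V x * \<epsilon>\<^sup>2 + \<epsilon>\<^sup>2"
        proof -
          have half: "y / 2 \<le> z" if "y \<le> z" "0 \<le> z" for y z :: real using that by simp
          show ?thesis
            unfolding energy_density_def using Vx
            by (intro half add_mono \<open>V x * (ut x 0)\<^sup>2 \<le> V x * \<epsilon>\<^sup>2\<close> \<open>(ux x 0)\<^sup>2 \<le> \<epsilon>\<^sup>2\<close>) auto
        qed
        have "?P x 0 \<le> \<rho>" using \<rho> one_plus_square_pos[of "x - x0"] by (simp add: cone_height_def)
        then have "(?P x 0)\<^sup>2 \<le> \<rho>\<^sup>2" by (intro power_mono) (auto simp: cone_height_def)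
        then have "(?P x 0)\<^sup>2 * energy_density x 0 \<le> \<rho>\<^sup>2 * (V x * \<epsilon>\<^sup>2 + \<epsilon>\<^sup>2)"
          using e energy_density_nonneg[of x 0] x a by (intro mult_mono) auto
        then show "1 * (?P x 0)\<^sup>2 * energy_density x 0 \<le> V x * (\<rho>\<^sup>2 * \<epsilon>\<^sup>2) + \<rho>\<^sup>2 * \<epsilon>\<^sup>2"
          by (simp add: algebra_simps)
      qed
      also have "\<dots> = integral {a..R} (\<lambda>x. V x * (\<rho>\<^sup>2 * \<epsilon>\<^sup>2)) + integral {a..R} (\<lambda>x. \<rho>\<^sup>2 * \<epsilon>\<^sup>2)"
        using a by (intro integral_add V_times_integrable continuous_intros integrable_const_ivl) auto
      also have "\<dots> \<le> C * integral {a..R} (\<lambda>x. \<rho>\<^sup>2 * \<epsilon>\<^sup>2) + integral {a..R} (\<lambda>x. \<rho>\<^sup>2 * \<epsilon>\<^sup>2)"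
        using a by (intro add_right_mono V_integral_le continuous_intros) auto
      also have "\<dots> = (C + 1) * (\<rho>\<^sup>2 * \<epsilon>\<^sup>2 * (2 * \<rho>))"
        using a by (simp add: algebra_simps)
      also have "\<dots> \<le> (\<bar>C\<bar> + 1) * (\<rho>\<^sup>2 * \<epsilon>\<^sup>2 * (2 * \<rho>))"
        using \<rho> by (intro mult_right_mono) auto
      also have "\<dots> = M * \<epsilon>\<^sup>2" by (simp add: M_def)
      finally show ?thesis .
    qed
    also have "M * \<epsilon>\<^sup>2 = \<delta> / 4" using M by (simp add: \<epsilon>2)
    finally show "integral {x0..x0 + 1} (\<lambda>x. energy_density x t) \<le> \<delta>" by simp
  qed
qed

lemma flux_increment:
  assumes ab: "0 \<le> a" "a \<le> b" and st: "0 \<le> s" "s \<le> t"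
  shows "((\<lambda>x. V x * (ut x t - ut x s)) has_integral
    (integral {s..t} (ux b) - integral {s..t} (ux a))) {a..b}"
proof (rule fundamental_theorem_of_calculus_interior_strong[OF D_finite[of b] ab(2)])
  fix x assume "x \<in> {a<..<b} - D \<inter> {0..b}"
  then show "((\<lambda>x. integral {s..t} (ux x)) has_vector_derivative V x * (ut x t - ut x s)) (at x)"
    unfolding has_real_derivative_iff_has_vector_derivative[symmetric]
    using ab st by (intro time_integrated_flux_deriv) auto
next
  have "continuous_on ({a..b} \<times> cbox s t) (\<lambda>(x, r). ux x r)"
    by (rule continuous_on_subset[OF ux_cont]) (use ab st in auto)
  from integral_continuous_on_param[OF this]
  show "continuous_on {a..b} (\<lambda>x. integral {s..t} (ux x))" by simp
qed

lemma abs_le_young: "\<eta> > 0 \<Longrightarrow> \<bar>y\<bar> \<le> \<eta> / 2 + y\<^sup>2 / 2 / \<eta>" for \<eta> y :: real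
  using sum_squares_bound[of \<eta> "\<bar>y\<bar>"] by (simp add: field_simps power2_eq_square)

text \<open>
  The inequality of the arithmetic and geometric mean with parameter \<open>\<eta>\<close> replaces that of Cauchy and Schwarz.
\<close>
lemma integral_abs_le_energy:
  assumes a: "0 \<le> a" and t: "t \<ge> 0" and \<eta>: "\<eta> > 0"
    and E: "integral {a..a + 1} (\<lambda>x. energy_density x t) \<le> \<eta>\<^sup>2"
  shows "integral {a..a + 1} (\<lambda>x. \<bar>ux x t\<bar>) \<le> 2 * \<eta>"
    "integral {a..a + 1} (\<lambda>x. V x * \<bar>ut x t\<bar>) \<le> (\<bar>C\<bar> + 1) * \<eta>"
proof -
  have ux_c: "continuous_on {a..a + 1} (\<lambda>x. ux x t)" and ut_c: "continuous_on {a..a + 1} (\<lambda>x. ut x t)"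
    using a t by (intro ux_cont' ut_cont' continuous_intros; simp)+
  have e_int: "(\<lambda>x. 1 / \<eta> * energy_density x t) integrable_on {a..a + 1}"
    using a t by (intro energy_density_integrable continuous_intros)
  have E': "integral {a..a + 1} (\<lambda>x. 1 / \<eta> * energy_density x t) \<le> \<eta>"
    using E \<eta> by (simp add: field_simps power2_eq_square)
  have "integral {a..a + 1} (\<lambda>x. \<bar>ux x t\<bar>) \<le> integral {a..a + 1} (\<lambda>x. \<eta> / 2 + 1 / \<eta> * energy_density x t)"
  proof (rule integral_le)
    show "(\<lambda>x. \<bar>ux x t\<bar>) integrable_on {a..a + 1}"
      by (intro integrable_continuous_real continuous_intros ux_c)
    show "(\<lambda>x. \<eta> / 2 + 1 / \<eta> * energy_density x t) integrable_on {a..a + 1}"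
      by (intro integrable_add integrable_const_ivl e_int)
    fix x assume "x \<in> {a..a + 1}"
    then have "V x * (ut x t)\<^sup>2 \<ge> 0" using V_pos[of x] a by simp
    then have "(ux x t)\<^sup>2 / 2 / \<eta> \<le> 1 / \<eta> * energy_density x t"
      using \<eta> by (simp add: energy_density_def divide_simps)
    then show "\<bar>ux x t\<bar> \<le> \<eta> / 2 + 1 / \<eta> * energy_density x t"
      using abs_le_young[OF \<eta>, of "ux x t"] by linarith
  qed
  also have "\<dots> = \<eta> / 2 + integral {a..a + 1} (\<lambda>x. 1 / \<eta> * energy_density x t)"
    by (subst integral_add[OF integrable_const_ivl e_int]) simp
  finally show "integral {a..a + 1} (\<lambda>x. \<bar>ux x t\<bar>) \<le> 2 * \<eta>" using E' \<eta> by linarith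
  have "integral {a..a + 1} (\<lambda>x. V x * \<bar>ut x t\<bar>) \<le>
      integral {a..a + 1} (\<lambda>x. V x * (\<eta> / 2) + 1 / \<eta> * energy_density x t)"
  proof (rule integral_le)
    show "(\<lambda>x. V x * \<bar>ut x t\<bar>) integrable_on {a..a + 1}"
      using a by (intro V_times_integrable continuous_intros ut_c)
    show "(\<lambda>x. V x * (\<eta> / 2) + 1 / \<eta> * energy_density x t) integrable_on {a..a + 1}"
      using a by (intro integrable_add V_times_integrable continuous_intros e_int)
    fix x assume "x \<in> {a..a + 1}"
    then have Vx: "V x > 0" using V_pos[of x] a by simp
    then have "V x * \<bar>ut x t\<bar> \<le> V x * (\<eta> / 2 + (ut x t)\<^sup>2 / 2 / \<eta>)"
      by (intro mult_left_mono abs_le_young \<eta>) auto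
    also have "\<dots> \<le> V x * (\<eta> / 2) + 1 / \<eta> * energy_density x t"
      using \<eta> by (simp add: energy_density_def field_simps)
    finally show "V x * \<bar>ut x t\<bar> \<le> V x * (\<eta> / 2) + 1 / \<eta> * energy_density x t" .
  qed
  also have "\<dots> = integral {a..a + 1} (\<lambda>x. V x * (\<eta> / 2)) + integral {a..a + 1} (\<lambda>x. 1 / \<eta> * energy_density x t)"
    using a by (intro integral_add V_times_integrable continuous_intros e_int)
  also have "integral {a..a + 1} (\<lambda>x. V x * (\<eta> / 2)) \<le> C * integral {a..a + 1} (\<lambda>x. \<eta> / 2)"
    using a \<eta> by (intro V_integral_le continuous_intros) auto
  also have "C * integral {a..a + 1} (\<lambda>x. \<eta> / 2) \<le> \<bar>C\<bar> * \<eta>"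
  proof -
    have "C * (\<eta> / 2) \<le> \<bar>C\<bar> * (\<eta> / 2)" using \<eta> by (intro mult_right_mono) auto
    moreover have "0 \<le> \<bar>C\<bar> * \<eta>" using \<eta> by simp
    ultimately show ?thesis by simp
  qed
  finally show "integral {a..a + 1} (\<lambda>x. V x * \<bar>ut x t\<bar>) \<le> (\<bar>C\<bar> + 1) * \<eta>"
    using E' by (simp add: algebra_simps)
qed

text \<open>
  Let \<open>\<Phi>(x)\<close> be the flux through \<open>x\<close> integrated over \<open>[s, t]\<close>. It is the derivative of \<open>\<integral> u(x, r) dr\<close>, so at some \<open>\<xi>\<close>
  in \<open>[R, R + 1]\<close> it equals \<open>\<integral> (u(R + 1, r) - u(R, r)) dr\<close>, which is small because \<open>\<integral> \<bar>u\<^sub>x\<bar> dx\<close> over \<open>[R, R + 1]\<close> is small.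
  By the time-integrated wave equation \<open>\<Phi>(\<xi>) - \<Phi>(R)\<close> is an integral of \<open>V (u\<^sub>t(x, t) - u\<^sub>t(x, s))\<close>, which is small as
  well. The local energy controls both.
\<close>
lemma time_integrated_flux_tendsto_0:
  assumes decay: "((\<lambda>x. ut x 0) \<longlongrightarrow> 0) at_top" "((\<lambda>x. ux x 0) \<longlongrightarrow> 0) at_top"
    and st: "0 \<le> s" "s \<le> t"
  shows "((\<lambda>R. integral {s..t} (ux R)) \<longlongrightarrow> 0) at_top"
proof (rule tendstoI)
  fix \<epsilon> :: real assume \<epsilon>: "\<epsilon> > 0"
  define A where "A = 2 * (t - s) + 2 * (\<bar>C\<bar> + 1)"
  have A: "A > 0" using st by (simp add: A_def add_nonneg_pos)
  define \<eta> where "\<eta> = \<epsilon> / (2 * A)"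
  have \<eta>: "\<eta> > 0" using A \<epsilon> by (simp add: \<eta>_def)
  obtain X where X: "X > 0" "\<And>x r. x \<ge> X \<Longrightarrow> 0 \<le> r \<Longrightarrow> r \<le> t \<Longrightarrow>
      integral {x..x + 1} (\<lambda>x. energy_density x r) \<le> \<eta>\<^sup>2"
    using local_energy_decay[OF decay, of t "\<eta>\<^sup>2"] st \<eta> by auto
  have "\<bar>integral {s..t} (ux R)\<bar> < \<epsilon>" if R: "R \<ge> X" for R
  proof -
    have R0: "R > 0" using R X by simp
    have small: "integral {R..R + 1} (\<lambda>x. \<bar>ux x r\<bar>) \<le> 2 * \<eta>"
      "integral {R..R + 1} (\<lambda>x. V x * \<bar>ut x r\<bar>) \<le> (\<bar>C\<bar> + 1) * \<eta>" if "0 \<le> r" "r \<le> t" for r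
      using integral_abs_le_energy[OF _ _ \<eta> X(2)[OF R]] R0 that by auto
    have diff: "\<bar>u (R + 1) r - u R r\<bar> \<le> 2 * \<eta>" if r: "0 \<le> r" "r \<le> t" for r
    proof -
      have "((\<lambda>x. ux x r) has_integral u (R + 1) r - u R r) {R..R + 1}"
        by (intro fundamental_theorem_of_calculus)
          (use R0 r in \<open>auto intro!: has_field_derivative_subset[OF u_deriv_x]
            simp: has_real_derivative_iff_has_vector_derivative[symmetric]\<close>)
      moreover have "norm (integral {R..R + 1} (\<lambda>x. ux x r)) \<le> integral {R..R + 1} (\<lambda>x. \<bar>ux x r\<bar>)"
        using R0 r
        by (intro integral_norm_bound_integral integrable_continuous_real continuous_intros ux_cont') auto
      ultimately show ?thesis using small(1)[OF r] by (simp add: integral_unique)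
    qed
    have u_deriv: "((\<lambda>x. integral (cbox s t) (u x)) has_real_derivative integral (cbox s t) (ux x))
        (at x within {R..R + 1})" if "x \<in> {R..R + 1}" for x
    proof (rule leibniz_rule_field_derivative)
      show "((\<lambda>x. u x r) has_real_derivative ux x r) (at x within {R..R + 1})"
        if "x \<in> {R..R + 1}" "r \<in> cbox s t" for x r
        using that R0 st by (intro has_field_derivative_subset[OF u_deriv_x]) auto
      show "u x integrable_on cbox s t" if "x \<in> {R..R + 1}" for x
      proof -
        have "continuous_on {0..} (u x)"
          using that R0 by (intro DERIV_continuous_on[OF u_deriv_t]) auto
        then show ?thesis using st by (intro integrable_continuous) (auto elim: continuous_on_subset)
      qed
      show "continuous_on ({R..R + 1} \<times> cbox s t) (\<lambda>(x, r). ux x r)"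
        by (rule continuous_on_subset[OF ux_cont]) (use R0 st in auto)
    qed (use that in auto)
    have "((\<lambda>x. integral (cbox s t) (u x)) has_derivative (*) (integral (cbox s t) (ux x)))
        (at x within {R..R + 1})" if "R \<le> x" "x \<le> R + 1" for x
      using u_deriv[of x] that by (simp add: has_field_derivative_def)
    from mvt_simple[OF _ this] obtain \<xi> where \<xi>: "\<xi> \<in> {R<..<R + 1}"
      "integral {s..t} (ux \<xi>) = integral {s..t} (u (R + 1)) - integral {s..t} (u R)" by auto
    have u_int: "u x integrable_on {s..t}" if "x \<ge> 0" for x
    proof -
      have "continuous_on {0..} (u x)"
        using that by (intro DERIV_continuous_on[OF u_deriv_t]) auto
      then show ?thesis using st by (intro integrable_continuous_real) (auto elim: continuous_on_subset)
    qed
    have 1: "\<bar>integral {s..t} (ux \<xi>)\<bar> \<le> 2 * \<eta> * (t - s)"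
    proof -
      have "integral {s..t} (ux \<xi>) = integral {s..t} (\<lambda>r. u (R + 1) r - u R r)"
        using \<xi>(2) R0 by (simp add: integral_diff u_int)
      moreover have "norm (integral {s..t} (\<lambda>r. u (R + 1) r - u R r)) \<le> integral {s..t} (\<lambda>r. 2 * \<eta>)"
        using R0 st diff by (intro integral_norm_bound_integral integrable_diff u_int integrable_const_ivl) auto
      ultimately show ?thesis using st by (simp add: mult_ac)
    qed
    have ut_c: "continuous_on {R..R + 1} (\<lambda>x. ut x r)" if "r \<ge> 0" for r
      using R0 that by (intro ut_cont' continuous_intros) auto
    have 2: "\<bar>integral {s..t} (ux \<xi>) - integral {s..t} (ux R)\<bar> \<le> 2 * ((\<bar>C\<bar> + 1) * \<eta>)"
    proof -
      let ?g = "\<lambda>x. V x * \<bar>ut x t\<bar> + V x * \<bar>ut x s\<bar>"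
      have g_int: "?g integrable_on {R..b}" if "b \<le> R + 1" for b
        using R0 st that
        by (intro integrable_add V_times_integrable continuous_intros continuous_on_subset[OF ut_c]) auto
      have fi: "((\<lambda>x. V x * (ut x t - ut x s)) has_integral
          (integral {s..t} (ux \<xi>) - integral {s..t} (ux R))) {R..\<xi>}"
        using R0 \<xi> st by (intro flux_increment) auto
      have "norm (integral {R..\<xi>} (\<lambda>x. V x * (ut x t - ut x s))) \<le> integral {R..\<xi>} ?g"
      proof (rule integral_norm_bound_integral)
        show "(\<lambda>x. V x * (ut x t - ut x s)) integrable_on {R..\<xi>}" using fi by blast
        show "?g integrable_on {R..\<xi>}" using \<xi> by (intro g_int) auto
        fix x assume "x \<in> {R..\<xi>}"
        then have "V x > 0" using R0 V_pos by simp
        then show "norm (V x * (ut x t - ut x s)) \<le> ?g x"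
          using abs_triangle_ineq4[of "ut x t" "ut x s"]
          by (simp add: abs_mult distrib_left[symmetric])
      qed
      also have "\<dots> \<le> integral {R..R + 1} ?g"
      proof (rule integral_subset_le)
        show "\<forall>x\<in>{R..R + 1}. 0 \<le> ?g x" using R0 V_pos by (auto simp: less_imp_le)
      qed (use \<xi> g_int in auto)
      also have "\<dots> = integral {R..R + 1} (\<lambda>x. V x * \<bar>ut x t\<bar>) + integral {R..R + 1} (\<lambda>x. V x * \<bar>ut x s\<bar>)"
        using R0 st by (intro integral_add V_times_integrable continuous_intros ut_c) auto
      also have "\<dots> \<le> 2 * ((\<bar>C\<bar> + 1) * \<eta>)" using small(2)[of t] small(2)[of s] st by simp
      finally show ?thesis using integral_unique[OF fi] by simp
    qed
    have "\<bar>integral {s..t} (ux R)\<bar> \<le> A * \<eta>" using 1 2 by (simp add: A_def algebra_simps)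
    also have "A * \<eta> < \<epsilon>" using A \<epsilon> by (simp add: \<eta>_def)
    finally show ?thesis .
  qed
  then show "\<forall>\<^sub>F R in at_top. dist (integral {s..t} (ux R)) 0 < \<epsilon>"
    unfolding eventually_at_top_linorder by auto
qed

end

context boundary_wave_field begin

lemma truncated_momentum_increment:
  assumes st: "0 \<le> s" "s \<le> t" and R: "R \<ge> 0"
  shows "((LBINT x:{0..R}. V x * ut x t) + f (ut 0 t)) - ((LBINT x:{0..R}. V x * ut x s) + f (ut 0 s)) =
    integral {s..t} (ux R)"
proof -
  have c: "continuous_on {0..R} (\<lambda>x. ut x r)" if "r \<ge> 0" for r
    using that by (intro ut_cont' continuous_intros) auto
  have L: "(LBINT x:{0..R}. V x * ut x r) = integral {0..R} (\<lambda>x. V x * ut x r)" if "r \<ge> 0" for r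
    using V_times_integrable(1)[OF _ c[OF that]] by (simp add: set_borel_integral_eq_integral)
  have "integral {0..R} (\<lambda>x. V x * ut x t) - integral {0..R} (\<lambda>x. V x * ut x s) =
      integral {0..R} (\<lambda>x. V x * ut x t - V x * ut x s)"
    using st by (intro integral_diff[symmetric] V_times_integrable c) auto
  also have "\<dots> = integral {s..t} (ux R) - integral {s..t} (ux 0)"
    using integral_unique[OF flux_increment[of 0 R s t]] R st by (simp add: right_diff_distrib)
  finally have "integral {0..R} (\<lambda>x. V x * ut x t) - integral {0..R} (\<lambda>x. V x * ut x s) =
      integral {s..t} (ux R) - integral {s..t} (ux 0)" .
  moreover have "(ux 0 has_integral f (ut 0 t) - f (ut 0 s)) {s..t}"
  proof (rule fundamental_theorem_of_calculus[OF st(2)])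
    fix r assume "r \<in> {s..t}"
    then show "((\<lambda>r. f (ut 0 r)) has_vector_derivative ux 0 r) (at r within {s..t})"
      unfolding has_real_derivative_iff_has_vector_derivative[symmetric]
      using st by (intro has_field_derivative_subset[OF boundary]) auto
  qed
  ultimately show ?thesis using st by (simp add: L integral_unique)
qed

text \<open>
  Truncated momenta at two times differ by the flux at the cut-off point, which vanishes in the limit;
  hence they have the same limit, finite or infinite, or none.
\<close>
lemma momentum_limit_transfer:
  assumes decay: "((\<lambda>x. ut x 0) \<longlongrightarrow> 0) at_top" "((\<lambda>x. ux x 0) \<longlongrightarrow> 0) at_top"
    and s: "s \<ge> 0" and t: "t \<ge> 0"
    and M: "((\<lambda>R. ereal ((LBINT x:{0..R}. V x * ut x s) + f (ut 0 s))) \<longlongrightarrow> l) at_top"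
  shows "((\<lambda>R. ereal ((LBINT x:{0..R}. V x * ut x t) + f (ut 0 t))) \<longlongrightarrow> l) at_top"
proof -
  let ?M = "\<lambda>t R. (LBINT x:{0..R}. V x * ut x t) + f (ut 0 t)"
  define \<sigma> :: real where "\<sigma> = (if s \<le> t then 1 else - 1)"
  define \<Phi> where "\<Phi> R = \<sigma> * integral {min s t..max s t} (ux R)" for R
  have "(\<Phi> \<longlongrightarrow> \<sigma> * 0) at_top"
    unfolding \<Phi>_def using s t by (intro tendsto_intros time_integrated_flux_tendsto_0 decay) auto
  then have "((\<lambda>R. ereal (\<Phi> R)) \<longlongrightarrow> ereal 0) at_top" by simp
  from tendsto_add_ereal_general1[OF _ M this]
  have "((\<lambda>R. ereal (?M s R) + ereal (\<Phi> R)) \<longlongrightarrow> l) at_top" by simp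
  moreover have "\<forall>\<^sub>F R in at_top. ereal (?M s R) + ereal (\<Phi> R) = ereal (?M t R)"
    using eventually_ge_at_top[of 0]
  proof eventually_elim
    case (elim R)
    have "\<Phi> R = ?M t R - ?M s R"
      using truncated_momentum_increment[of s t R] truncated_momentum_increment[of t s R] s t elim
      by (cases "s \<le> t") (auto simp: \<Phi>_def \<sigma>_def)
    then show ?case by simp
  qed
  ultimately show ?thesis by (rule Lim_transform_eventually)
qed

end

section \<open>Total energy\<close>
lemma nn_integral_half_line_le_iff:
  fixes g :: "real \<Rightarrow> real"
  assumes meas: "(\<lambda>x. indicator {0..} x * g x) \<in> borel_measurable borel"
    and g: "\<And>x. x \<ge> 0 \<Longrightarrow> 0 \<le> g x" "\<And>R. g integrable_on {0..R}" and K: "K \<ge> 0"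
  shows "(\<integral>\<^sup>+x\<in>{0..}. ennreal (g x) \<partial>lborel) \<le> ennreal K \<longleftrightarrow> (\<forall>R\<ge>0. integral {0..R} g \<le> K)"
proof -
  let ?g = "\<lambda>x. indicator {0..} x * g x"
  have g0: "0 \<le> ?g x" for x using g(1)[of x] by (simp add: indicator_def)
  have trunc: "(\<integral>\<^sup>+x. ennreal (g x) * indicator {0..R} x \<partial>lborel) = ennreal (integral {0..R} g)" for R
  proof -
    have "((\<lambda>x. if x \<in> {0..R} then g x else 0) has_integral integral {0..R} g) UNIV"
      using integrable_integral[OF g(2)[of R]] by (simp only: has_integral_restrict_UNIV)
    moreover have "(\<lambda>x. if x \<in> {0..R} then g x else 0) = (\<lambda>x. indicator {0..R} x * ?g x)"
      by (auto simp: indicator_def fun_eq_iff)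
    ultimately have "((\<lambda>x. indicator {0..R} x * ?g x) has_integral integral {0..R} g) UNIV" by simp
    moreover have "(\<lambda>x. indicator {0..R} x * ?g x) \<in> borel_measurable borel"
      using meas by measurable
    ultimately have "(\<integral>\<^sup>+x. ennreal (indicator {0..R} x * ?g x) \<partial>lborel) = ennreal (integral {0..R} g)"
      using g0 by (intro nn_integral_has_integral_lborel) auto
    moreover have "ennreal (indicator {0..R} x * ?g x) = ennreal (g x) * indicator {0..R} x" for x
      by (auto simp: indicator_def)
    ultimately show ?thesis by simp
  qed
  have all: "(\<integral>\<^sup>+x\<in>{0..}. ennreal (g x) \<partial>lborel) = (SUP n. ennreal (integral {0..real n} g))"
  proof -
    have "ennreal (g x) * indicator {0..} x = (SUP n. ennreal (g x) * indicator {0..real n} x)" for x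
    proof (rule antisym)
      obtain n where n: "x \<le> real n" using real_arch_simple by blast
      then have "ennreal (g x) * indicator {0..} x = ennreal (g x) * indicator {0..real n} x"
        by (auto simp: indicator_def)
      also have "\<dots> \<le> (SUP n. ennreal (g x) * indicator {0..real n} x)" by (rule SUP_upper) simp
      finally show "ennreal (g x) * indicator {0..} x \<le> (SUP n. ennreal (g x) * indicator {0..real n} x)" .
      show "(SUP n. ennreal (g x) * indicator {0..real n} x) \<le> ennreal (g x) * indicator {0..} x"
        by (rule SUP_least) (auto simp: indicator_def)
    qed
    then have "(\<integral>\<^sup>+x\<in>{0..}. ennreal (g x) \<partial>lborel) =
        (\<integral>\<^sup>+x. (SUP n. ennreal (g x) * indicator {0..real n} x) \<partial>lborel)" by simp
    also have "\<dots> = (SUP n. \<integral>\<^sup>+x. ennreal (g x) * indicator {0..real n} x \<partial>lborel)"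
    proof (rule nn_integral_monotone_convergence_SUP)
      show "incseq (\<lambda>n x. ennreal (g x) * indicator {0..real n} x)"
        by (auto simp: incseq_def le_fun_def indicator_def)
      fix n
      have "(\<lambda>x. ennreal (?g x) * indicator {0..real n} x) \<in> borel_measurable lborel"
        using meas by measurable
      moreover have "ennreal (?g x) * indicator {0..real n} x = ennreal (g x) * indicator {0..real n} x" for x
        by (auto simp: indicator_def)
      ultimately show "(\<lambda>x. ennreal (g x) * indicator {0..real n} x) \<in> borel_measurable lborel" by simp
    qed
    finally show ?thesis by (simp only: trunc)
  qed
  show ?thesis
  proof
    assume le: "(\<integral>\<^sup>+x\<in>{0..}. ennreal (g x) \<partial>lborel) \<le> ennreal K"
    show "\<forall>R\<ge>0. integral {0..R} g \<le> K"
    proof (intro allI impI)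
      fix R :: real assume "R \<ge> 0"
      have "ennreal (integral {0..R} g) \<le> (\<integral>\<^sup>+x\<in>{0..}. ennreal (g x) \<partial>lborel)"
        unfolding trunc[symmetric] by (intro nn_integral_mono) (auto simp: indicator_def)
      with le have "ennreal (integral {0..R} g) \<le> ennreal K" by (rule order_trans[rotated])
      then show "integral {0..R} g \<le> K" using K by (simp add: ennreal_le_iff)
    qed
  next
    assume "\<forall>R\<ge>0. integral {0..R} g \<le> K"
    then show "(\<integral>\<^sup>+x\<in>{0..}. ennreal (g x) \<partial>lborel) \<le> ennreal K"
      unfolding all by (intro SUP_least ennreal_leI) auto
  qed
qed

context boundary_wave_field begin

definition total_energy :: "real \<Rightarrow> ereal" where
  "total_energy t = ereal (1 / 2) * enn2ereal (\<integral>\<^sup>+x\<in>{0..}. ennreal (V x * (ut x t)\<^sup>2 + (ux x t)\<^sup>2) \<partial>lborel) +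
    ereal (boundary_energy f (ut 0 t))"

text \<open>
  If the energy at time \<open>s\<close> is finite, \<open>energy_domination\<close> bounds the truncated energies at time \<open>t\<close> by it, and
  the truncations increase to the full integral. Exchanging \<open>s\<close> and \<open>t\<close> gives equality.
\<close>
lemma total_energy_mono:
  assumes s: "s \<ge> 0" and t: "t \<ge> 0"
  shows "total_energy t \<le> total_energy s"
proof -
  let ?g = "\<lambda>t x. V x * (ut x t)\<^sup>2 + (ux x t)\<^sup>2"
  let ?I = "\<lambda>t. \<integral>\<^sup>+x\<in>{0..}. ennreal (?g t x) \<partial>lborel"
  let ?B = "\<lambda>t. boundary_energy f (ut 0 t)"
  have g_e: "?g r x = 2 * energy_density x r" for r x by (simp add: energy_density_def)
  have I_le_iff: "?I r \<le> ennreal (2 * K) \<longleftrightarrow> (\<forall>R\<ge>0. integral {0..R} (\<lambda>x. energy_density x r) \<le> K)"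
    if r: "r \<ge> 0" and K: "K \<ge> 0" for r K
  proof -
    have ind: "(\<lambda>x. indicator {0..} x * ut x r) \<in> borel_measurable borel"
      "(\<lambda>x. indicator {0..} x * ux x r) \<in> borel_measurable borel"
      using r borel_measurable_continuous_on_indicator[of "{0..}" "\<lambda>x. ut x r"]
        borel_measurable_continuous_on_indicator[of "{0..}" "\<lambda>x. ux x r"]
        ut_cont'[of "{0..}" "\<lambda>x. x" "\<lambda>x. r"] ux_cont'[of "{0..}" "\<lambda>x. x" "\<lambda>x. r"]
      by (auto intro!: continuous_intros)
    have "(\<lambda>x. (indicator {0..} x * V x) * (indicator {0..} x * ut x r)\<^sup>2 + (indicator {0..} x * ux x r)\<^sup>2)
        \<in> borel_measurable borel"
      by (intro borel_measurable_add borel_measurable_times[OF V_measurable] borel_measurable_power ind)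
    moreover have "(\<lambda>x. (indicator {0..} x * V x) * (indicator {0..} x * ut x r)\<^sup>2 + (indicator {0..} x * ux x r)\<^sup>2)
        = (\<lambda>x. indicator {0..} x * ?g r x)"
      by (auto simp: indicator_def fun_eq_iff)
    ultimately have "(\<lambda>x. indicator {0..} x * ?g r x) \<in> borel_measurable borel" by (simp only:)
    then have "?I r \<le> ennreal (2 * K) \<longleftrightarrow> (\<forall>R\<ge>0. integral {0..R} (?g r) \<le> 2 * K)"
    proof (rule nn_integral_half_line_le_iff)
      show "?g r integrable_on {0..R}" for R
        unfolding g_e using r by (intro energy_density_integrable continuous_intros) auto
    qed (use K energy_density_nonneg g_e in auto)
    then show ?thesis by (simp add: g_e)
  qed
  show ?thesis
  proof (cases "?I s = \<infinity>")
    case True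
    then show ?thesis by (simp add: total_energy_def)
  next
    case False
    define K where "K = enn2real (?I s) / 2"
    have K: "K \<ge> 0" "?I s = ennreal (2 * K)" using False by (auto simp: K_def less_top)
    then have "\<forall>R\<ge>0. integral {0..R} (\<lambda>x. energy_density x s) \<le> K"
      using I_le_iff[OF s K(1)] by simp
    then have bound: "integral {0..L} (\<lambda>x. energy_density x t) \<le> K + ?B s - ?B t" if "L \<ge> 0" for L
      using energy_domination[OF s t that, of K] by simp
    have K': "K + ?B s - ?B t \<ge> 0" using bound[of 0] by simp
    then have "?I t \<le> ennreal (2 * (K + ?B s - ?B t))"
      using I_le_iff[OF t K'] bound by blast
    then have "enn2ereal (?I t) \<le> ereal (2 * (K + ?B s - ?B t))"
      using K' by (simp add: less_eq_ennreal.rep_eq enn2ereal_ennreal)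
    then have "ereal (1 / 2) * enn2ereal (?I t) \<le> ereal (1 / 2) * ereal (2 * (K + ?B s - ?B t))"
      by (intro ereal_mult_left_mono) auto
    also have "ereal (1 / 2) * ereal (2 * (K + ?B s - ?B t)) = ereal (K + ?B s - ?B t)" by simp
    finally have "total_energy t \<le> ereal (K + ?B s - ?B t) + ereal (?B t)"
      unfolding total_energy_def by (rule add_right_mono)
    also have "\<dots> = total_energy s" using K by (simp add: total_energy_def enn2ereal_ennreal)
    finally show ?thesis .
  qed
qed

end

section \<open>Solutions of the wave equation\<close>
lemma hderiv_eq:
  assumes "(\<phi> has_real_derivative d) (at x within {0..})" "x \<ge> 0"
  shows "hderiv \<phi> x = d"
proof -
  have "at x within {0..} \<noteq> bot"
    unfolding trivial_limit_within
    using islimpt_subset[OF islimpt_greaterThanLessThan1[of x "x + 1"], of "{0..}"] assms(2)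
    by (simp add: subset_eq)
  then show ?thesis
    unfolding hderiv_def using assms(1)
    by (intro vector_derivative_within) (auto simp: has_real_derivative_iff_has_vector_derivative)
qed

lemma C1_on_quadrant_partials:
  assumes "C1_on ({0..} \<times> {0..}) (\<lambda>(x, t). u x t)"
  shows "continuous_on ({0..} \<times> {0..}) (\<lambda>(x, t). partial_t u x t)"
    and "continuous_on ({0..} \<times> {0..}) (\<lambda>(x, t). partial_x u x t)"
    and "\<And>x t. x \<ge> 0 \<Longrightarrow> t \<ge> 0 \<Longrightarrow>
      ((\<lambda>s. u x s) has_real_derivative partial_t u x t) (at t within {0..})"
    and "\<And>x t. x \<ge> 0 \<Longrightarrow> t \<ge> 0 \<Longrightarrow>
      ((\<lambda>y. u y t) has_real_derivative partial_x u x t) (at x within {0..})"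
proof -
  obtain D where D: "\<And>p. p \<in> {0..} \<times> {0..} \<Longrightarrow>
      ((\<lambda>(x, t). u x t) has_derivative blinfun_apply (D p)) (at p within {0..} \<times> {0..})"
    and D_cont: "continuous_on ({0..} \<times> {0..}) D"
    using assms unfolding C1_on_def by blast
  have t: "((\<lambda>s. u x s) has_real_derivative blinfun_apply (D (x, t)) (0, 1)) (at t within {0..})"
    and x: "((\<lambda>y. u y t) has_real_derivative blinfun_apply (D (x, t)) (1, 0)) (at x within {0..})"
    if "x \<ge> 0" "t \<ge> 0" for x t
  proof -
    have lin: "blinfun_apply (D (x, t)) (h, 0) = blinfun_apply (D (x, t)) (1, 0) * h"
      "blinfun_apply (D (x, t)) (0, h) = blinfun_apply (D (x, t)) (0, 1) * h" for h
      using blinfun.scaleR_right[of "D (x, t)" h "(1, 0)"] blinfun.scaleR_right[of "D (x, t)" h "(0, 1)"]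
      by (auto simp: mult.commute)
    have lin_fun: "(\<lambda>h. blinfun_apply (D (x, t)) (h, 0)) = (*) (blinfun_apply (D (x, t)) (1, 0))"
      "(\<lambda>h. blinfun_apply (D (x, t)) (0, h)) = (*) (blinfun_apply (D (x, t)) (0, 1))"
      by (rule ext, rule lin)+
    have D1: "((\<lambda>(x, t). u x t) has_derivative blinfun_apply (D (x, t))) (at (x, t) within A)"
      if "A \<subseteq> {0..} \<times> {0..}" for A
      using D[of "(x, t)"] \<open>x \<ge> 0\<close> \<open>t \<ge> 0\<close> that by (auto elim: has_derivative_subset)
    have "((\<lambda>s. (x, s)) has_derivative (\<lambda>h. (0, h))) (at t within {0..})"
      "((\<lambda>y. (y, t)) has_derivative (\<lambda>h. (h, 0))) (at x within {0..})"
      by (auto intro!: derivative_eq_intros)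
    note * = this
    have "((\<lambda>s. case (x, s) of (x, t) \<Rightarrow> u x t) has_derivative (\<lambda>h. blinfun_apply (D (x, t)) (0, h))) (at t within {0..})"
      using that by (intro has_derivative_in_compose[OF *(1)] D1) auto
    then show "((\<lambda>s. u x s) has_real_derivative blinfun_apply (D (x, t)) (0, 1)) (at t within {0..})"
      by (simp only: has_field_derivative_def lin_fun prod.case)
    have "((\<lambda>y. case (y, t) of (x, t) \<Rightarrow> u x t) has_derivative (\<lambda>h. blinfun_apply (D (x, t)) (h, 0))) (at x within {0..})"
      using that by (intro has_derivative_in_compose[OF *(2)] D1) auto
    then show "((\<lambda>y. u y t) has_real_derivative blinfun_apply (D (x, t)) (1, 0)) (at x within {0..})"
      by (simp only: has_field_derivative_def lin_fun prod.case)
  qed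
  have eq: "partial_t u x t = blinfun_apply (D (x, t)) (0, 1)" "partial_x u x t = blinfun_apply (D (x, t)) (1, 0)"
    if "x \<ge> 0" "t \<ge> 0" for x t
    unfolding partial_t_def partial_x_def using hderiv_eq[OF t] hderiv_eq[OF x] that by auto
  show "((\<lambda>s. u x s) has_real_derivative partial_t u x t) (at t within {0..})"
    "((\<lambda>y. u y t) has_real_derivative partial_x u x t) (at x within {0..})"
    if "x \<ge> 0" "t \<ge> 0" for x t
    using t[OF that] x[OF that] eq[OF that] by auto
  have "continuous_on ({0..} \<times> {0..}) (\<lambda>v. blinfun_apply (D v) (0, 1))"
    by (intro continuous_intros D_cont)
  then show "continuous_on ({0..} \<times> {0..}) (\<lambda>(x, t). partial_t u x t)"
    by (rule continuous_on_eq) (auto simp: eq)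
  have "continuous_on ({0..} \<times> {0..}) (\<lambda>v. blinfun_apply (D v) (1, 0))"
    by (intro continuous_intros D_cont)
  then show "continuous_on ({0..} \<times> {0..}) (\<lambda>(x, t). partial_x u x t)"
    by (rule continuous_on_eq) (auto simp: eq)
qed

text \<open>
  In the open quadrant the restriction to increments that stay in the quadrant is void near \<open>0\<close>.
\<close>
lemma transport_derivative_at:
  assumes "has_transport_derivative c w x t d" "x > 0" "t > 0"
  shows "((\<lambda>h. w (x - c x * h) (t + h)) has_real_derivative d) (at 0)"
proof -
  have "open {h. 0 < x - c x * h \<and> 0 < t + h}"
    by (intro open_Collect_conj open_Collect_less continuous_intros)
  moreover have "{h. 0 < x - c x * h \<and> 0 < t + h} \<subseteq> {h. 0 \<le> x - c x * h \<and> 0 \<le> t + h}" by auto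
  ultimately have "0 \<in> interior {h. 0 \<le> x - c x * h \<and> 0 \<le> t + h}"
    using assms(2,3) by (intro interiorI[of "{h. 0 < x - c x * h \<and> 0 < t + h}"]) auto
  then have "at 0 within {h. 0 \<le> x - c x * h \<and> 0 \<le> t + h} = at 0"
    by (rule at_within_interior)
  then show ?thesis using assms(1) by (simp add: has_transport_derivative_def)
qed

theorem theorem1p4:
  fixes V f u0 u1 :: "real \<Rightarrow> real" and u :: "real \<Rightarrow> real \<Rightarrow> real"
  assumes A0: "C1_on {0..} u0" "continuous_on {0..} u1"
    and A1: "piecewise_C 1 {0..} V" "ess_bounded V" "ess_bounded (hderiv V)"
      "\<exists>m>0. \<forall>x\<ge>0. m \<le> V x"
    and A2: "\<exists>\<delta>>0. \<forall>d1\<in>discont V \<union> {0}. \<forall>d2\<in>discont V \<union> {0}. d1 \<noteq> d2 \<longrightarrow> \<delta> \<le> \<bar>d1 - d2\<bar>"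
    and A3: "increasing_homeomorphism f"
    and solution: "C1_solution V f u0 u1 u"
    and decay: "(hderiv u0 \<longlongrightarrow> 0) at_top" "(u1 \<longlongrightarrow> 0) at_top"
  shows "\<forall>s\<ge>0. \<forall>t\<ge>0. (\<forall>m. has_momentum V f u s m \<longleftrightarrow> has_momentum V f u t m) \<and>
    energy V f u s = energy V f u t"
proof -
  obtain D d where D: "D \<subseteq> {0..}" "\<And>x. x \<ge> 0 \<Longrightarrow> \<not> x islimpt D" and d0: "d (0::nat) = V"
    and d_deriv: "\<And>j x. j < 1 \<Longrightarrow> x \<in> {0..} - D \<Longrightarrow> (d j has_real_derivative d (Suc j) x) (at x within {0..})"
    and d_cont: "\<And>j. j \<le> 1 \<Longrightarrow> continuous_on ({0..} - D) (d j)"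
    using A1(1) unfolding piecewise_C_def by auto
  define V' where "V' = d 1"
  have V_deriv: "(V has_real_derivative V' x) (at x within {0..})" if "x \<ge> 0" "x \<notin> D" for x
    using d_deriv[of 0 x] that by (simp add: d0 V'_def)
  have V_cont: "continuous_on ({0..} - D) V" and V'_cont: "continuous_on ({0..} - D) V'"
    using d_cont[of 0] d_cont[of 1] by (simp_all add: d0 V'_def)
  obtain m where m: "m > 0" "\<And>x. x \<ge> 0 \<Longrightarrow> m \<le> V x" using A1(4) by blast
  have V_pos: "V x > 0" if "x \<ge> 0" for x using m that by (meson less_le_trans)
  obtain C where C: "AE x in lborel. 0 \<le> x \<longrightarrow> \<bar>V x\<bar> \<le> C" using A1(2) unfolding ess_bounded_def by blast
  have D_closed: "closed D"
    unfolding closed_limpt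
  proof (intro allI impI)
    fix x assume x: "x islimpt D"
    then have "x islimpt {0..}" using D(1) islimpt_subset by blast
    then have "x \<in> {0..}" using closed_limpt[of "{0::real..}"] by auto
    then show "x \<in> D" using D(2) x by auto
  qed
  let ?c = "speed V"
  define c' where "c' x = - V' x / (2 * V x * sqrt (V x))" for x
  have c_deriv: "(?c has_real_derivative c' x) (at x within {0..})" if "x \<ge> 0" "x \<notin> D" for x
    unfolding speed_def c'_def using V_pos[OF that(1)]
    by (auto intro!: derivative_eq_intros V_deriv[OF that] simp: field_simps)
  have c'_cont: "continuous_on ({0..} - D) c'"
    unfolding c'_def using V_pos by (intro continuous_intros V_cont V'_cont) (auto simp: less_le)
  have C1: "C1_on ({0..} \<times> {0..}) (\<lambda>(x, t). u x t)"
    and transport: "\<And>x t. x \<ge> 0 \<Longrightarrow> t \<ge> 0 \<Longrightarrow> x \<notin> discont ?c \<union> discont_deriv ?c \<Longrightarrow>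
        has_transport_derivative ?c (\<lambda>y s. partial_t u y s + ?c y * partial_x u y s) x t
          (- ?c x * hderiv ?c x * partial_x u x t)"
    and boundary: "\<And>t. t \<ge> 0 \<Longrightarrow>
        ((\<lambda>s. f (partial_t u 0 s)) has_real_derivative partial_x u 0 t) (at t within {0..})"
    and initial: "\<And>x. x \<ge> 0 \<Longrightarrow> u x 0 = u0 x" "\<And>x. x \<ge> 0 \<Longrightarrow> partial_t u x 0 = u1 x"
    using solution unfolding C1_solution_def by blast+
  (* Outside D the speed is C^1 near x, so the transport equation holds there. *)
  have regular: "x \<notin> discont ?c \<union> discont_deriv ?c" if x: "x \<ge> 0" "x \<notin> D" for x
  proof -
    have "continuous (at x within {0..}) ?c" using DERIV_continuous[OF c_deriv[OF x]] .
    moreover have "?c differentiable (at x within {0..})"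
      using c_deriv[OF x] real_differentiable_def by blast
    moreover have "continuous (at x within {0..}) (hderiv ?c)"
    proof -
      have x_nhd: "x \<in> - D" "open (- D)" using x D_closed by auto
      have "at x within {0..} = at x within ({0..} - D)"
        using x_nhd by (intro at_within_nhd[where S = "- D"]) auto
      moreover have "continuous (at x within ({0..} - D)) (hderiv ?c)"
      proof -
        have "continuous_on ({0..} - D) (hderiv ?c)"
          using c'_cont by (rule continuous_on_eq) (use hderiv_eq[OF c_deriv] in auto)
        then show ?thesis using x by (simp add: continuous_on_eq_continuous_within)
      qed
      ultimately show ?thesis by (simp add: continuous_within)
    qed
    ultimately show ?thesis by (simp add: discont_def discont_deriv_def)
  qed
  have f: "mono f" "continuous_on UNIV f"
    using A3 strict_mono_mono unfolding increasing_homeomorphism_def homeomorphism_def by blast+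
  interpret boundary_wave_field V ?c c' D u "partial_t u" "partial_x u" m C f
  proof unfold_locales
    show "finite (D \<inter> {0..R})" for R
      using finite_not_islimpt_in_compact[of "{0..R}" D] D(2) by (auto simp: Int_commute)
    show "AE x in lborel. 0 \<le> x \<longrightarrow> V x \<le> C" using C by eventually_elim auto
    show "(?c has_real_derivative c' x) (at x)" if "x > 0" "x \<notin> D" for x
    proof -
      have "at x within {0..} = at x"
        using that by (intro at_within_interior) (auto simp: interior_real_atLeast)
      then show ?thesis using c_deriv[of x] that by simp
    qed
    show "continuous_on ({0<..} - D) c'" by (rule continuous_on_subset[OF c'_cont]) auto
    show "((\<lambda>h. partial_t u (x - ?c x * h) (t + h) + ?c (x - ?c x * h) * partial_x u (x - ?c x * h) (t + h))
        has_real_derivative - ?c x * c' x * partial_x u x t) (at 0)" if "x > 0" "t > 0" "x \<notin> D" for x t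
      using transport_derivative_at[OF transport that(1,2)] regular[of x] hderiv_eq[OF c_deriv, of x] that
      by simp
  qed (use D_closed m f boundary C1_on_quadrant_partials[OF C1] in \<open>auto simp: speed_def\<close>)
  have "partial_x u x 0 = hderiv u0 x" if "x \<ge> 0" for x
  proof -
    have "((\<lambda>y. u y 0) has_real_derivative partial_x u x 0) (at x within {0..})"
      using C1_on_quadrant_partials(4)[OF C1] that by simp
    then have "(u0 has_real_derivative partial_x u x 0) (at x within {0..})"
      by (rule has_field_derivative_transform_within[where d = 1]) (use that initial in auto)
    then show ?thesis using hderiv_eq that by auto
  qed
  then have ux_initial: "\<forall>\<^sub>F x in at_top. hderiv u0 x = partial_x u x 0"
    by (intro eventually_mono[OF eventually_ge_at_top[of "0::real"]]) simp
  have ut_initial: "\<forall>\<^sub>F x in at_top. u1 x = partial_t u x 0"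
    by (intro eventually_mono[OF eventually_ge_at_top[of "0::real"]]) (simp add: initial(2))
  note decay' = Lim_transform_eventually[OF decay(2) ut_initial] Lim_transform_eventually[OF decay(1) ux_initial]
  have energy_eq: "energy V f u t = total_energy t" for t
    by (simp add: energy_def total_energy_def)
  show ?thesis
  proof (intro allI impI conjI)
    fix s t m :: real and l assume s: "0 \<le> s" and t: "0 \<le> t"
    show "has_momentum V f u s l \<longleftrightarrow> has_momentum V f u t l"
      unfolding has_momentum_def
      using momentum_limit_transfer[OF decay' s t] momentum_limit_transfer[OF decay' t s] by blast
    show "energy V f u s = energy V f u t"
      unfolding energy_eq using total_energy_mono[OF s t] total_energy_mono[OF t s] by (rule antisym[rotated])
  qed
qed

end
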